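(* Let $T$ be a proper tree of diameter six whose weighted core $(\mathcal C(T),\omega_T)$ is multiplicity-isolated. Then Stanley's tree-isomorphism conjecture holds for $T$: every tree $T'$ with $\mathbf X_{T'}=\mathbf X_T$ is isomorphic to $T$.
   Context: All trees are finite. For a finite simple graph $G$, the chromatic symmetric function is $\mathbf X_G=\sum_{\kappa}\prod_{v\in V(G)}x_{\kappa(v)}$, a formal power series in commuting variables $x_1,x_2,\dots$, where $\kappa$ ranges over all proper colorings $\kappa:V(G)\to\{1,2,3,\dots\}$ (adjacent vertices receive different colors). Stanley's tree-isomorphism conjecture asserts that trees with equal chromatic symmetric functions are isomorphic. A leaf is a vertex of degree one. The diameter of a tree is the maximum number of edges in a path. For a tree $T$, the internal core $\mathcal C(T)$ is the subtree induced by the nonleaf vertices of $T$. The tree $T$ is proper if every vertex of $\mathcal C(T)$ is adjacent in $T$ to at least one leaf of $T$. For a proper tree $T$ and $v\in V(\mathcal C(T))$ put $$\omega_T(v)=1+\#\{u\in V(T): u\text{ is a leaf of }T\text{ and }uv\in E(T)\}.$$ The weighted core of $T$ is the pair $(\mathcal C(T),\omega_T)$. It is multiplicity-isolated if for every $v\in V(\mathcal C(T))$ with $\deg_{\mathcal C(T)}(v)\ge 2$ one has $\omega_T^{-1}(\omega_T(v))=\{v\}$, i.e. no other vertex of $\mathcal C(T)$ has the same weight as $v$. *)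

theory Defs
  imports
    "Graph_Theory.Graph_Theory"
    "HOL-Library.FuncSet"
    "HOL-Library.Poly_Mapping"
    "HOL-Library.Groups_Big_Fun"
begin

text \<open>
  A finite simple graph is a \<open>graph\<close> in the sense of the AFP entry \<open>Graph_Theory\<close>: a finite
  symmetric digraph without loops and parallel arcs, so that every undirected edge \<open>uv\<close> is
  represented by the two arcs \<open>u \<rightarrow> v\<close> and \<open>v \<rightarrow> u\<close>. In particular, the degree of a vertex is its
  out-degree, and the number of edges in a path is the number of its arcs.
\<close>

text \<open>
  The predicate \<open>tree\<close> of \<open>Graph_Theory\<close> is not usable for symmetric digraphs, as there the closed
  walk \<open>u \<rightarrow> v \<rightarrow> u\<close> counts as a cycle. The cycles of length at least three are exactly the
  (oriented) cycles of the undirected graph. The null graph is not connected, hence not a tree.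
\<close>

definition undirected_tree :: "('a, 'b) pre_digraph \<Rightarrow> bool" where
  "undirected_tree G \<longleftrightarrow>
     graph G \<and> Digraph_Component.connected G \<and> \<not> (\<exists>p. pre_digraph.cycle G p \<and> length p \<ge> 3)"

definition is_leaf :: "('a, 'b) pre_digraph \<Rightarrow> 'a \<Rightarrow> bool" where
  "is_leaf G v \<longleftrightarrow> v \<in> verts G \<and> out_degree G v = 1"

definition graph_diameter :: "('a, 'b) pre_digraph \<Rightarrow> nat" where
  "graph_diameter G = Max {length p | u p v. pre_digraph.apath G u p v}"

definition internal_core :: "('a, 'b) pre_digraph \<Rightarrow> ('a, 'b) pre_digraph" where
  "internal_core T = T \<restriction> {v \<in> verts T. \<not> is_leaf T v}"

definition proper_tree :: "('a, 'b) pre_digraph \<Rightarrow> bool" where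
  "proper_tree T \<longleftrightarrow>
     undirected_tree T \<and> (\<forall>v \<in> verts (internal_core T). \<exists>u. is_leaf T u \<and> u \<rightarrow>\<^bsub>T\<^esub> v)"

text \<open>Only the values on \<open>verts (internal_core T)\<close> are meaningful.\<close>

definition core_weight :: "('a, 'b) pre_digraph \<Rightarrow> 'a \<Rightarrow> nat" where
  "core_weight T v = 1 + card {u \<in> verts T. is_leaf T u \<and> u \<rightarrow>\<^bsub>T\<^esub> v}"

definition multiplicity_isolated :: "('a, 'b) pre_digraph \<Rightarrow> ('a \<Rightarrow> nat) \<Rightarrow> bool" where
  "multiplicity_isolated C w \<longleftrightarrow>
     (\<forall>v \<in> verts C. out_degree C v \<ge> 2 \<longrightarrow> {u \<in> verts C. w u = w v} = {v})"

text \<open>Colorings are extensional, so that each coloring of the vertex set is counted once.\<close>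

definition proper_colorings :: "('a, 'b) pre_digraph \<Rightarrow> ('a \<Rightarrow> nat) set" where
  "proper_colorings G =
     {\<kappa> \<in> verts G \<rightarrow>\<^sub>E {1..}. \<forall>u v. u \<rightarrow>\<^bsub>G\<^esub> v \<longrightarrow> \<kappa> u \<noteq> \<kappa> v}"

text \<open>
  Polynomials over the integers in the commuting variables \<open>x\<^sub>0, x\<^sub>1, \<dots>\<close> are finitely supported maps
  from exponent vectors to coefficients, with the convolution product of \<open>Poly_Mapping\<close>.
  Dropping the condition of finite support yields formal power series.
\<close>

type_synonym power_series = "(nat \<Rightarrow>\<^sub>0 nat) \<Rightarrow> int"

definition indet :: "nat \<Rightarrow> (nat \<Rightarrow>\<^sub>0 nat) \<Rightarrow>\<^sub>0 int" where
  "indet i = Poly_Mapping.single (Poly_Mapping.single i 1) 1"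

text \<open>
  The infinite sum over all proper colorings is taken coefficientwise. Each coefficient is a sum
  with only finitely many nonzero terms (lemma \<open>finite_contributing\<close> below), so that the convention
  that \<open>Sum_any\<close> is zero for infinite support never applies.
\<close>

definition chromatic_symmetric_function :: "('a, 'b) pre_digraph \<Rightarrow> power_series" where
  "chromatic_symmetric_function G = (\<lambda>m. \<Sum>\<kappa>.
     Poly_Mapping.lookup (\<Prod>v\<in>verts G. indet (\<kappa> v)) m when \<kappa> \<in> proper_colorings G)"

lemma prod_indet:
  assumes "finite V"
  shows "(\<Prod>v\<in>V. indet (\<kappa> v)) =
    Poly_Mapping.single (\<Sum>v\<in>V. Poly_Mapping.single (\<kappa> v) 1) 1"
  using assms by (induction V rule: finite_induct) (simp_all add: indet_def mult_single)

lemma finite_contributing: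
  assumes "finite (verts G)"
  shows "finite {\<kappa> \<in> proper_colorings G. Poly_Mapping.lookup (\<Prod>v\<in>verts G. indet (\<kappa> v)) m \<noteq> 0}"
proof (rule finite_subset)
  show "finite (verts G \<rightarrow>\<^sub>E Poly_Mapping.keys m)"
    using assms by (intro finite_PiE) auto
  show "{\<kappa> \<in> proper_colorings G. Poly_Mapping.lookup (\<Prod>v\<in>verts G. indet (\<kappa> v)) m \<noteq> 0}
    \<subseteq> verts G \<rightarrow>\<^sub>E Poly_Mapping.keys m"
  proof (intro subsetI, elim CollectE conjE)
    fix \<kappa>
    assume \<kappa>: "\<kappa> \<in> proper_colorings G"
      and "Poly_Mapping.lookup (\<Prod>v\<in>verts G. indet (\<kappa> v)) m \<noteq> 0"
    then have m: "m = (\<Sum>v\<in>verts G. Poly_Mapping.single (\<kappa> v) 1)"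
      using assms by (auto simp: prod_indet lookup_single when_def split: if_splits)
    have "\<kappa> v \<in> Poly_Mapping.keys m" if "v \<in> verts G" for v
      using assms that by (auto simp: m lookup_sum in_keys_iff intro!: bexI[of _ v])
    then show "\<kappa> \<in> verts G \<rightarrow>\<^sub>E Poly_Mapping.keys m"
      using \<kappa> by (auto simp: proper_colorings_def PiE_def)
  qed
qed

lemma chromatic_symmetric_function_eq_card:
  assumes "finite (verts G)"
  shows "chromatic_symmetric_function G m =
    int (card {\<kappa> \<in> proper_colorings G. (\<Sum>v\<in>verts G. Poly_Mapping.single (\<kappa> v) 1) = m})"
proof -
  let ?A = "{\<kappa> \<in> proper_colorings G. (\<Sum>v\<in>verts G. Poly_Mapping.single (\<kappa> v) 1) = m}"
  have eq: "(Poly_Mapping.lookup (\<Prod>v\<in>verts G. indet (\<kappa> v)) m when \<kappa> \<in> proper_colorings G)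
      = (if \<kappa> \<in> ?A then 1 else 0)" for \<kappa>
    using assms by (auto simp: prod_indet lookup_single when_def)
  show ?thesis
    unfolding chromatic_symmetric_function_def eq Sum_any.expand_set by simp
qed

end

theory Submission
  imports Defs
begin

text \<open>
  By inclusion-exclusion over the monochromatic edges, \<open>X\<^sub>T\<close> is the sum of
  \<open>(-1)\<^bsup>|A|\<^esup> p\<^bsub>\<lambda>(A)\<^esub>\<close> over all edge sets \<open>A\<close>, where \<open>\<lambda>(A)\<close> lists the component sizes
  of \<open>A\<close>. In a tree \<open>|A|\<close> is determined by \<open>\<lambda>(A)\<close>, so nothing cancels and independence of the
  power sums yields the multiset of all \<open>\<lambda>(A)\<close>. The partitions without a part 1 come from edge
  sets without isolated vertices; in a proper tree these are exactly the supersets of the set \<open>L\<close>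
  of leaf edges. Counting those with two parts gives \<open>|L|\<close>, which forces \<open>T'\<close> to be proper as well.
  Then \<open>\<lambda>(L)\<close> is the multiset of core weights, and \<open>\<lambda>(L \<union> {e})\<close> differs from it by merging the two
  weights at the ends of the core edge \<open>e\<close>. Hence there is a bijection between the core edges of
  \<open>T\<close> and \<open>T'\<close> preserving the pairs of weights at the ends. Since every core edge has an end whose
  weight is unique and all other core vertices lie on a single core edge, that bijection is induced
  by an isomorphism of the weighted cores, which extends to the leaves.
\<close>

section \<open>Value-preserving bijections between finite sets with equal multisets of
  values\<close>

lemma bij_if_image_mset_eq:
  assumes "finite A" and "finite B"
    and "image_mset f (mset_set A) = image_mset g (mset_set B)"
  obtains h where "bij_betw h A B" and "\<And>x. x \<in> A \<Longrightarrow> g (h x) = f x"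
proof -
  have "\<exists>h. bij_betw h A B \<and> (\<forall>x\<in>A. g (h x) = f x)"
    using assms
  proof (induction A arbitrary: B rule: finite_induct)
    case empty
    then have "B = {}" by (simp add: mset_set_empty_iff)
    then show ?case by (simp add: bij_betw_def)
  next
    case (insert a A)
    from insert.prems(2) insert.hyps have eq: "image_mset g (mset_set B) = add_mset (f a) (image_mset f (mset_set A))"
      by simp
    then have "f a \<in># image_mset g (mset_set B)" by simp
    then obtain b where b: "b \<in> B" "g b = f a" using insert.prems(1) by auto
    have "B = insert b (B - {b})" using b by auto
    then have "mset_set B = add_mset b (mset_set (B - {b}))"
      using insert.prems(1) b by (metis mset_set.remove)
    with eq b have "image_mset f (mset_set A) = image_mset g (mset_set (B - {b}))" by simp
    from insert.IH[OF _ this] insert.prems obtain h where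
      h: "bij_betw h A (B - {b})" "\<forall>x\<in>A. g (h x) = f x" by auto
    have "bij_betw (h(a := b)) (insert a A) (insert b (B - {b}))"
      using h(1) insert.hyps by (auto simp: bij_betw_def inj_on_def)
    then have "bij_betw (h(a := b)) (insert a A) B"
      using \<open>B = insert b (B - {b})\<close> by simp
    moreover have "\<forall>x\<in>insert a A. g ((h(a := b)) x) = f x" using h(2) b(2) by auto
    ultimately show ?case by blast
  qed
  then show ?thesis using that by blast
qed

lemma image_mset_eq_if_bij:
  assumes "bij_betw h A B" and "\<And>x. x \<in> A \<Longrightarrow> g (h x) = f x"
  shows "image_mset f (mset_set A) = image_mset g (mset_set B)"
proof -
  have "image_mset g (mset_set B) = image_mset g (image_mset h (mset_set A))"
    using assms(1) by (simp add: bij_betw_def image_mset_mset_set)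
  also have "\<dots> = image_mset f (mset_set A)"
    unfolding multiset.map_comp
    by (cases "finite A") (auto intro!: image_mset_cong simp: assms(2))
  finally show ?thesis ..
qed

section \<open>Independence of the power sums\<close>

text \<open>This is the coefficient at \<open>m\<close> of the product of the power sums of degrees
  \<open>f i\<close> over \<open>i\<close> in \<open>I\<close>: expanding the product means choosing
  one variable \<open>\<kappa> i\<close> for each factor. If some \<open>f i\<close> is zero, the
  choice of \<open>\<kappa> i\<close> is not restricted by \<open>m\<close> and \<open>card\<close>
  returns 0, so later lemmas require positive parts.\<close>

definition colour_count :: "('i \<Rightarrow> nat) \<Rightarrow> 'i set \<Rightarrow> (nat \<Rightarrow>\<^sub>0 nat) \<Rightarrow> nat" where
  "colour_count f I m = card {\<kappa> \<in> I \<rightarrow>\<^sub>E {1..}. (\<Sum>i\<in>I. Poly_Mapping.single (\<kappa> i) (f i)) = m}"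

text \<open>Colourings are transported along a bijection of the index sets that matches
  \<open>f\<close> with \<open>g\<close>, so the count depends only on the multiset of
  degrees.\<close>

lemma colour_count_cong:
  assumes "finite I" and "finite J"
    and "image_mset f (mset_set I) = image_mset g (mset_set J)"
  shows "colour_count f I m = colour_count g J m"
proof -
  obtain h where h: "bij_betw h I J" and gh: "\<And>i. i \<in> I \<Longrightarrow> g (h i) = f i"
    using bij_if_image_mset_eq[OF assms] by blast
  let ?k = "inv_into I h"
  have k: "bij_betw ?k J I" using h by (rule bij_betw_inv_into)
  have kh: "?k (h i) = i" if "i \<in> I" for i using h that by (simp add: bij_betw_inv_into_left)
  have hk: "h (?k j) = j" if "j \<in> J" for j using h that by (simp add: bij_betw_inv_into_right)
  have hJ: "h i \<in> J" if "i \<in> I" for i using h that by (auto simp: bij_betw_def)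
  have kI: "?k j \<in> I" if "j \<in> J" for j using k that by (auto simp: bij_betw_def)
  have sum1: "(\<Sum>i\<in>I. Poly_Mapping.single (\<kappa> (h i)) (f i)) = (\<Sum>j\<in>J. Poly_Mapping.single (\<kappa> j) (g j))" for \<kappa> :: "_ \<Rightarrow> nat"
    using sum.reindex_bij_betw[OF h, of "\<lambda>j. Poly_Mapping.single (\<kappa> j) (g j)"] by (simp add: gh)
  have sum2: "(\<Sum>j\<in>J. Poly_Mapping.single (\<kappa> (?k j)) (g j)) = (\<Sum>i\<in>I. Poly_Mapping.single (\<kappa> i) (f i))" for \<kappa> :: "_ \<Rightarrow> nat"
    using sum1[of "\<lambda>j. \<kappa> (?k j)"] by (simp add: kh)
  let ?A = "{\<kappa> \<in> I \<rightarrow>\<^sub>E {1..}. (\<Sum>i\<in>I. Poly_Mapping.single (\<kappa> i) (f i)) = m}"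
  let ?B = "{\<kappa> \<in> J \<rightarrow>\<^sub>E {1..}. (\<Sum>i\<in>J. Poly_Mapping.single (\<kappa> i) (g i)) = m}"
  have "bij_betw (\<lambda>\<kappa>. restrict (\<lambda>j. \<kappa> (?k j)) J) ?A ?B"
  proof (rule bij_betw_byWitness[where f' = "\<lambda>\<kappa>. restrict (\<lambda>i. \<kappa> (h i)) I"])
    show "\<forall>\<kappa>\<in>?A. restrict (\<lambda>i. restrict (\<lambda>j. \<kappa> (?k j)) J (h i)) I = \<kappa>"
      by (intro ballI ext) (auto simp: kh hJ dest: PiE_arb)
    show "\<forall>\<kappa>\<in>?B. restrict (\<lambda>j. restrict (\<lambda>i. \<kappa> (h i)) I (?k j)) J = \<kappa>"
      by (intro ballI ext) (auto simp: hk kI dest: PiE_arb)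
    show "(\<lambda>\<kappa>. restrict (\<lambda>j. \<kappa> (?k j)) J) ` ?A \<subseteq> ?B"
      using kI by (auto simp: sum2 Pi_iff PiE_def)
    show "(\<lambda>\<kappa>. restrict (\<lambda>i. \<kappa> (h i)) I) ` ?B \<subseteq> ?A"
      using hJ by (auto simp: sum1 Pi_iff PiE_def)
  qed
  then show ?thesis unfolding colour_count_def by (rule bij_betw_same_card)
qed

lemma image_mset_nth: "image_mset ((!) xs) (mset_set {..<length xs}) = mset xs"
proof -
  have "mset (map ((!) xs) [0..<length xs]) = image_mset ((!) xs) (mset_set {0..<length xs})"
    by (simp only: mset_map mset_upt)
  then show ?thesis by (simp add: map_nth atLeast0LessThan)
qed

text \<open>The coefficients of the power sum product indexed by the partition \<open>\<mu>\<close>.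
  The positions in the sorted list serve as a canonical index set.\<close>

definition power_sum_coeff :: "nat multiset \<Rightarrow> (nat \<Rightarrow>\<^sub>0 nat) \<Rightarrow> nat" where
  "power_sum_coeff \<mu> = colour_count ((!) (sorted_list_of_multiset \<mu>)) {..<size \<mu>}"

lemma image_mset_nth_sorted_list:
  "image_mset ((!) (sorted_list_of_multiset \<mu>)) (mset_set {..<size \<mu>}) = \<mu>"
  using image_mset_nth[of "sorted_list_of_multiset \<mu>"]
  by (simp add: size_mset[symmetric] del: size_mset)

lemma colour_count_eq_power_sum_coeff:
  assumes "finite I"
  shows "colour_count f I = power_sum_coeff (image_mset f (mset_set I))"
  unfolding power_sum_coeff_def
  by (intro ext colour_count_cong assms)
     (simp_all only: finite_lessThan image_mset_nth_sorted_list)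

text \<open>The exponent of a monomial in which all parts of \<open>\<mu>\<close> receive different
  variables. Positions are shifted by \<open>Suc\<close> because colours start at 1.\<close>

definition leading_exponent :: "nat multiset \<Rightarrow> (nat \<Rightarrow>\<^sub>0 nat)" where
  "leading_exponent \<mu> =
     (\<Sum>i<size \<mu>. Poly_Mapping.single (Suc i) (sorted_list_of_multiset \<mu> ! i))"

lemma lookup_leading_exponent:
  "Poly_Mapping.lookup (leading_exponent \<mu>) (Suc i) = (if i < size \<mu> then sorted_list_of_multiset \<mu> ! i else 0)"
  by (simp add: leading_exponent_def lookup_sum lookup_single when_def)

lemma keys_leading_exponent:
  assumes "0 \<notin># \<mu>"
  shows "Poly_Mapping.keys (leading_exponent \<mu>) = Suc ` {..<size \<mu>}"
proof -
  have pos: "sorted_list_of_multiset \<mu> ! i \<noteq> 0" if "i < size \<mu>" for i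
    using assms that by (metis nth_mem set_sorted_list_of_multiset size_mset mset_sorted_list_of_multiset)
  have zero: "Poly_Mapping.lookup (leading_exponent \<mu>) 0 = 0"
    by (simp add: leading_exponent_def lookup_sum lookup_single when_def)
  have "k \<in> Poly_Mapping.keys (leading_exponent \<mu>) \<longleftrightarrow> k \<in> Suc ` {..<size \<mu>}" for k
    using pos by (cases k) (auto simp: in_keys_iff zero lookup_leading_exponent)
  then show ?thesis by blast
qed

text \<open>Giving position \<open>i\<close> the variable \<open>Suc i\<close> is one admissible
  choice. Finiteness must be checked as well, since \<open>card\<close> is 0 on infinite sets; it
  holds because nonzero parts confine the choices to the variables that occur in the
  monomial.\<close>

lemma power_sum_coeff_self:
  assumes "0 \<notin># \<mu>"
  shows "power_sum_coeff \<mu> (leading_exponent \<mu>) > 0"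
proof -
  let ?f = "(!) (sorted_list_of_multiset \<mu>)" and ?I = "{..<size \<mu>}"
  let ?A = "{\<kappa> \<in> ?I \<rightarrow>\<^sub>E {1..}. (\<Sum>i\<in>?I. Poly_Mapping.single (\<kappa> i) (?f i)) = leading_exponent \<mu>}"
  have pos: "?f i \<noteq> 0" if "i < size \<mu>" for i
    using assms that by (metis nth_mem set_sorted_list_of_multiset size_mset mset_sorted_list_of_multiset)
  have "?A \<subseteq> ?I \<rightarrow>\<^sub>E Poly_Mapping.keys (leading_exponent \<mu>)"
  proof
    fix \<kappa> assume "\<kappa> \<in> ?A"
    then have e: "leading_exponent \<mu> = (\<Sum>i\<in>?I. Poly_Mapping.single (\<kappa> i) (?f i))" and k: "\<kappa> \<in> ?I \<rightarrow>\<^sub>E {1..}"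
      by auto
    have "\<kappa> i \<in> Poly_Mapping.keys (leading_exponent \<mu>)" if "i < size \<mu>" for i
      unfolding e using pos[OF that] that
      by (auto simp: in_keys_iff lookup_sum lookup_single intro!: bexI[of _ i])
    with k show "\<kappa> \<in> ?I \<rightarrow>\<^sub>E Poly_Mapping.keys (leading_exponent \<mu>)"
      by (auto simp: PiE_def)
  qed
  then have "finite ?A" by (rule finite_subset) (auto intro: finite_PiE)
  moreover have "restrict Suc ?I \<in> ?A"
    by (auto simp: leading_exponent_def)
  then have "?A \<noteq> {}" by blast
  ultimately have "card ?A > 0" unfolding card_gt_0_iff by blast
  then show ?thesis
    unfolding power_sum_coeff_def colour_count_def .
qed

text \<open>A map contributing to the coefficient merges the parts of \<open>\<mu>\<close> into those of \<open>\<nu>\<close>.\<close>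

lemma power_sum_coeff_nonzero:
  assumes "0 \<notin># \<nu>" and "power_sum_coeff \<mu> (leading_exponent \<nu>) \<noteq> 0"
    and "size \<mu> \<le> size \<nu>"
  shows "\<mu> = \<nu>"
proof -
  let ?f = "(!) (sorted_list_of_multiset \<mu>)" and ?I = "{..<size \<mu>}"
  let ?g = "(!) (sorted_list_of_multiset \<nu>)" and ?J = "{..<size \<nu>}"
  let ?A = "{\<kappa> \<in> ?I \<rightarrow>\<^sub>E {1..}. (\<Sum>i\<in>?I. Poly_Mapping.single (\<kappa> i) (?f i)) = leading_exponent \<nu>}"
  from assms(2) have "card ?A \<noteq> 0" unfolding power_sum_coeff_def colour_count_def .
  then have "?A \<noteq> {}" by (metis card.empty)
  then obtain \<kappa> where e: "(\<Sum>i\<in>?I. Poly_Mapping.single (\<kappa> i) (?f i)) = leading_exponent \<nu>"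
    by blast
  have sub: "Suc ` ?J \<subseteq> \<kappa> ` ?I"
  proof
    fix k assume "k \<in> Suc ` ?J"
    then have "Poly_Mapping.lookup (\<Sum>i\<in>?I. Poly_Mapping.single (\<kappa> i) (?f i)) k \<noteq> 0"
      using keys_leading_exponent[OF assms(1)] by (auto simp: e in_keys_iff)
    then show "k \<in> \<kappa> ` ?I"
      by (auto simp: lookup_sum lookup_single when_def split: if_splits)
  qed
  have "size \<nu> = card (Suc ` ?J)" by (simp add: card_image)
  also have "\<dots> \<le> card (\<kappa> ` ?I)" by (intro card_mono sub) simp
  finally have le: "size \<nu> \<le> card (\<kappa> ` ?I)" .
  have le': "card (\<kappa> ` ?I) \<le> size \<mu>" using card_image_le[of ?I \<kappa>] by simp
  \<comment> \<open>Every one of the \<open>size \<nu>\<close> variables must be hit, and there are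
    at most that many parts in \<open>\<mu>\<close>. Hence \<open>\<kappa>\<close> is injective and
    no two parts are merged.\<close>
  from le le' assms(3) have "card (\<kappa> ` ?I) = card ?I" and "card (\<kappa> ` ?I) = card (Suc ` ?J)"
    by (auto simp: card_image)
  then have inj: "inj_on \<kappa> ?I" and img: "\<kappa> ` ?I = Suc ` ?J"
    using card_subset_eq[OF _ sub] by (auto intro: eq_card_imp_inj_on)
  have bij: "bij_betw (\<lambda>i. \<kappa> i - 1) ?I ?J"
  proof -
    have "bij_betw (\<lambda>k. k - 1) (Suc ` ?J) ?J"
      by (rule bij_betw_byWitness[where f' = Suc]) auto
    moreover have "bij_betw \<kappa> ?I (Suc ` ?J)" using inj img by (simp add: bij_betw_def)
    ultimately have "bij_betw ((\<lambda>k. k - 1) \<circ> \<kappa>) ?I ?J" by (rule bij_betw_trans[rotated])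
    then show ?thesis by (simp add: comp_def)
  qed
  have "?g (\<kappa> i - 1) = ?f i" if i: "i \<in> ?I" for i
  proof -
    have "\<kappa> i \<in> Suc ` ?J" using i img by auto
    then obtain j where j: "j < size \<nu>" "\<kappa> i = Suc j" by auto
    have "Poly_Mapping.lookup (leading_exponent \<nu>) (\<kappa> i) = (\<Sum>i'\<in>?I. if i' = i then ?f i' else 0)"
      unfolding e[symmetric] lookup_sum lookup_single
      using inj i by (intro sum.cong) (auto simp: when_def inj_on_def)
    also have "\<dots> = ?f i" using i by simp
    finally show ?thesis using j by (simp add: lookup_leading_exponent)
  qed
  then have "image_mset ?f (mset_set ?I) = image_mset ?g (mset_set ?J)"
    by (rule image_mset_eq_if_bij[OF bij])
  then show ?thesis by (simp only: image_mset_nth_sorted_list)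
qed

lemma sum_mset_eq_sum_count:
  fixes f :: "'x \<Rightarrow> int"
  assumes "finite S" and "set_mset M \<subseteq> S"
  shows "(\<Sum>x\<in>#M. f x) = (\<Sum>x\<in>S. int (count M x) * f x)"
  using assms(2)
proof (induction M)
  case (add y M)
  have "(\<Sum>x\<in>S. int (count (add_mset y M) x) * f x) = (\<Sum>x\<in>S. (if x = y then f y else 0) + int (count M x) * f x)"
    by (intro sum.cong) (auto simp: algebra_simps)
  also have "\<dots> = f y + (\<Sum>x\<in>S. int (count M x) * f x)"
    using add.prems assms(1) by (simp add: sum.distrib)
  finally show ?case using add by simp
qed simp

text \<open>A triangularity argument: among the partitions with different multiplicities in
  \<open>M\<close> and \<open>N\<close>, one of maximal size is chosen, and the coefficients at its
  leading exponent are compared. The nonzero scalars \<open>s\<close> make room for the sign of an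
  edge set, which depends only on its partition.\<close>

lemma power_sums_independent:
  fixes M N :: "nat multiset multiset"
  assumes pos: "\<And>\<mu>. \<mu> \<in># M + N \<Longrightarrow> 0 \<notin># \<mu>"
    and sgn: "\<And>\<mu>. s \<mu> \<noteq> (0 :: int)"
    and eq: "\<And>m. (\<Sum>\<mu>\<in>#M. s \<mu> * int (power_sum_coeff \<mu> m)) =
                   (\<Sum>\<mu>\<in>#N. s \<mu> * int (power_sum_coeff \<mu> m))"
  shows "M = N"
proof (rule ccontr)
  assume "M \<noteq> N"
  define D where "D = {\<mu>. count M \<mu> \<noteq> count N \<mu>}"
  let ?S = "set_mset (M + N)"
  have sub: "D \<subseteq> ?S" unfolding D_def by (auto simp: not_in_iff)
  then have "finite D" by (rule finite_subset) simp
  moreover have "D \<noteq> {}" using \<open>M \<noteq> N\<close> unfolding D_def by (auto simp: multiset_eq_iff)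
  ultimately obtain \<nu> where l: "\<nu> \<in> D" and max: "\<And>\<mu>. \<mu> \<in> D \<Longrightarrow> size \<mu> \<le> size \<nu>"
    using finite_imageI[of D size] Max_in[of "size ` D"] Max_ge[of "size ` D"] by (metis (no_types, lifting) empty_is_image imageE imageI)
  have "0 \<notin># \<nu>" using l sub pos by blast
  let ?g = "\<lambda>\<mu>. s \<mu> * int (power_sum_coeff \<mu> (leading_exponent \<nu>))"
  have "(\<Sum>\<mu>\<in>?S. int (count M \<mu>) * ?g \<mu>) = (\<Sum>\<mu>\<in>?S. int (count N \<mu>) * ?g \<mu>)"
    using eq[of "leading_exponent \<nu>"] sum_mset_eq_sum_count[of ?S M ?g] sum_mset_eq_sum_count[of ?S N ?g]
    by auto
  then have "0 = (\<Sum>\<mu>\<in>?S. (int (count M \<mu>) - int (count N \<mu>)) * ?g \<mu>)"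
    by (simp add: left_diff_distrib sum_subtractf)
  \<comment> \<open>Outside \<open>D\<close> the multiplicities cancel. Inside \<open>D\<close>,
    maximality of \<open>size \<nu>\<close> means that no partition other than \<open>\<nu>\<close>
    reaches this exponent.\<close>
  also have "\<dots> = (\<Sum>\<mu>\<in>?S. if \<mu> = \<nu> then (int (count M \<nu>) - int (count N \<nu>)) * ?g \<nu> else 0)"
  proof (intro sum.cong refl)
    fix \<mu>
    have "?g \<mu> = 0" if "\<mu> \<in> D" "\<mu> \<noteq> \<nu>"
      using power_sum_coeff_nonzero[OF \<open>0 \<notin># \<nu>\<close> _ max[OF that(1)]] that(2) by auto
    then show "(int (count M \<mu>) - int (count N \<mu>)) * ?g \<mu>
        = (if \<mu> = \<nu> then (int (count M \<nu>) - int (count N \<nu>)) * ?g \<nu> else 0)"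
      by (auto simp: D_def)
  qed
  also have "\<dots> = (int (count M \<nu>) - int (count N \<nu>)) * ?g \<nu>"
    using l sub by (subst sum.delta) auto
  finally show False
    using l power_sum_coeff_self[OF \<open>0 \<notin># \<nu>\<close>] sgn[of \<nu>] by (simp add: D_def)
qed

section \<open>Edge subsets of a tree and their components\<close>

definition adj :: "'a set set \<Rightarrow> 'a rel" where
  "adj A = {(u, v). {u, v} \<in> A}"

definition component :: "'a set set \<Rightarrow> 'a \<Rightarrow> 'a set" where
  "component A u = (adj A)\<^sup>* `` {u}"

lemma sym_adj: "sym (adj A)"
  by (auto simp: sym_def adj_def insert_commute)

lemma component_self [simp]: "u \<in> component A u"
  by (simp add: component_def)

lemma component_eq_iff: "component A u = component A v \<longleftrightarrow> v \<in> component A u"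
proof
  assume "v \<in> component A u"
  then have "(u, v) \<in> (adj A)\<^sup>*" by (simp add: component_def)
  moreover from this have "(v, u) \<in> (adj A)\<^sup>*" by (rule symD[OF sym_rtrancl[OF sym_adj]])
  ultimately show "component A u = component A v"
    by (auto simp: component_def intro: rtrancl_trans)
next
  assume "component A u = component A v"
  then show "v \<in> component A u" by simp
qed

lemma component_sym: "v \<in> component A u \<longleftrightarrow> u \<in> component A v"
  by (metis component_eq_iff)

lemma component_least:
  assumes "u \<in> S" and "\<And>x y. x \<in> S \<Longrightarrow> {x, y} \<in> A \<Longrightarrow> y \<in> S"
  shows "component A u \<subseteq> S"
proof
  fix v assume "v \<in> component A u"
  then have "(u, v) \<in> (adj A)\<^sup>*" by (simp add: component_def)
  then show "v \<in> S"
    by (induction rule: rtrancl_induct) (auto simp: adj_def assms)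
qed

text \<open>The new edge fuses the components of its ends and leaves the others alone: one inclusion
  is monotonicity together with the new link, the other holds because the right-hand side is closed
  under all edges.\<close>

lemma component_insert:
  "component (insert {a, b} A) x =
     (if a \<in> component A x \<or> b \<in> component A x then component A a \<union> component A b else component A x)"
    (is "?L = ?R")
proof
  have mono: "component A y \<subseteq> component (insert {a, b} A) y" for y
    unfolding component_def by (intro Image_mono rtrancl_mono) (auto simp: adj_def)
  have "(a, b) \<in> adj (insert {a, b} A)" by (simp add: adj_def)
  then have ab: "component (insert {a, b} A) a = component (insert {a, b} A) b"
    unfolding component_eq_iff by (auto simp: component_def)
  show "?R \<subseteq> ?L"
  proof (cases "a \<in> component A x \<or> b \<in> component A x")
    case True
    then have "component (insert {a, b} A) x = component (insert {a, b} A) a"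
      using mono[of x] ab by (metis component_eq_iff subsetD)
    then show ?thesis using True mono[of a] mono[of b] ab by auto
  qed (use mono[of x] in auto)
  show "?L \<subseteq> ?R"
  proof (rule component_least)
    show "x \<in> ?R" using component_sym[of x A] by auto
    fix y z assume y: "y \<in> ?R" and yz: "{y, z} \<in> insert {a, b} A"
    have step: "z \<in> component A y" if "{y, z} \<in> A"
      using that by (auto simp: component_def adj_def)
    show "z \<in> ?R"
    proof (cases "{y, z} = {a, b}")
      case True
      then show ?thesis using y by (auto simp: doubleton_eq_iff split: if_splits)
    next
      case False
      with yz step have "z \<in> component A y" by auto
      with y show ?thesis using component_eq_iff[of A] by (metis UnE UnI1 UnI2)
    qed
  qed
qed

text \<open>Subsets with and without a fixed element cancel. Applied to the set of monochromatic
  edges of a colouring, the sum becomes the indicator of properness.\<close>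

lemma sum_Pow_neg_one:
  assumes "finite X"
  shows "(\<Sum>A\<in>Pow X. (-1) ^ card A) = (if X = {} then 1 else 0 :: int)"
  using assms
proof (induction X rule: finite_induct)
  case (insert x X)
  have inj: "inj_on (insert x) (Pow X)" using insert.hyps by (auto simp: inj_on_def)
  have "(\<Sum>A\<in>Pow (insert x X). (-1) ^ card A) =
      (\<Sum>A\<in>Pow X. (-1) ^ card A) + (\<Sum>A\<in>Pow X. (-1) ^ card (insert x A) :: int)"
    unfolding Pow_insert using insert.hyps
    by (subst sum.union_disjoint) (auto simp: sum.reindex[OF inj])
  also have "(\<Sum>A\<in>Pow X. (-1) ^ card (insert x A) :: int) = (\<Sum>A\<in>Pow X. - ((-1) ^ card A))"
  proof (intro sum.cong refl)
    fix A assume "A \<in> Pow X"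
    then have "card (insert x A) = Suc (card A)"
      using insert.hyps finite_subset by (subst card_insert_disjoint) auto
    then show "(-1) ^ card (insert x A) = - ((-1) ^ card A :: int)" by simp
  qed
  finally show ?case by (simp add: sum_negf)
qed simp

lemma sum_single_const: "finite B \<Longrightarrow> (\<Sum>v\<in>B. Poly_Mapping.single k (1::nat)) = Poly_Mapping.single k (card B)"
  by (induction B rule: finite_induct) (simp_all add: single_add[symmetric])

locale edge_tree =
  fixes V :: "'a set" and E :: "'a set set"
  assumes finite_V: "finite V"
    and edgeE: "e \<in> E \<Longrightarrow> \<exists>u v. e = {u, v} \<and> u \<noteq> v \<and> u \<in> V \<and> v \<in> V"
    and connected: "u \<in> V \<Longrightarrow> component E u = V"
    and bridge: "{u, v} \<in> E \<Longrightarrow> v \<notin> component (E - {{u, v}}) u"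
begin

definition components :: "'a set set \<Rightarrow> 'a set set" where
  "components A = component A ` V"

definition parts :: "'a set set \<Rightarrow> nat multiset" where
  "parts A = image_mset card (mset_set (components A))"

lemma edge_in_V: "{u, v} \<in> E \<Longrightarrow> u \<in> V \<and> v \<in> V \<and> u \<noteq> v"
  using edgeE[of "{u, v}"] by (auto simp: doubleton_eq_iff)

lemma finite_E: "finite E"
  by (rule finite_subset[of _ "Pow V"]) (use edgeE finite_V in \<open>auto\<close>)

lemma component_subset: "A \<subseteq> E \<Longrightarrow> u \<in> V \<Longrightarrow> component A u \<subseteq> V"
  by (rule component_least) (use edge_in_V in auto)

lemma finite_component: "A \<subseteq> E \<Longrightarrow> u \<in> V \<Longrightarrow> finite (component A u)"
  using component_subset finite_V finite_subset by metis

lemma finite_components [simp]: "finite (components A)"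
  by (simp add: components_def finite_V)

lemma bridge_subset:
  assumes "A \<subseteq> E" and "{u, v} \<in> E - A"
  shows "v \<notin> component A u"
proof -
  have "component A u \<subseteq> component (E - {{u, v}}) u"
    unfolding component_def by (intro Image_mono rtrancl_mono) (use assms in \<open>auto simp: adj_def\<close>)
  then show ?thesis using bridge[of u v] assms by auto
qed

text \<open>A new edge is a bridge, so it merges two distinct components and replaces their sizes by
  the sum. The equation is stated with additions on both sides to avoid truncated subtraction of
  multisets.\<close>

lemma parts_insert:
  assumes A: "A \<subseteq> E" and ab: "{a, b} \<in> E - A"
  shows "parts (insert {a, b} A) + {#card (component A a), card (component A b)#} =
         parts A + {#card (component A a) + card (component A b)#}"
proof -
  let ?a = "component A a" and ?b = "component A b"
  have V: "a \<in> V" "b \<in> V" using ab edge_in_V by auto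
  have ne: "?a \<noteq> ?b" using bridge_subset[OF A ab] by (simp add: component_eq_iff)
  have disj: "?a \<inter> ?b = {}"
    using ne by (metis component_eq_iff disjoint_iff)
  have eq: "components (insert {a, b} A) = insert (?a \<union> ?b) (components A - {?a, ?b})"
  proof (intro equalityI subsetI)
    fix X assume "X \<in> components (insert {a, b} A)"
    then obtain x where x: "x \<in> V" "X = component (insert {a, b} A) x"
      unfolding components_def by blast
    show "X \<in> insert (?a \<union> ?b) (components A - {?a, ?b})"
    proof (cases "a \<in> component A x \<or> b \<in> component A x")
      case True
      then show ?thesis using x(2) by (simp add: component_insert)
    next
      case False
      then have "X = component A x" using x(2) by (simp add: component_insert)
      moreover from this have "X \<noteq> ?a" "X \<noteq> ?b" using False component_self by metis+
      ultimately show ?thesis using x(1) unfolding components_def by blast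
    qed
  next
    fix X assume X: "X \<in> insert (?a \<union> ?b) (components A - {?a, ?b})"
    show "X \<in> components (insert {a, b} A)"
    proof (cases "X = ?a \<union> ?b")
      case True
      then have "X = component (insert {a, b} A) a" by (simp add: component_insert)
      then show ?thesis using V by (auto simp: components_def)
    next
      case False
      with X obtain x where x: "x \<in> V" "X = component A x" "X \<noteq> ?a" "X \<noteq> ?b"
        unfolding components_def by blast
      then have "a \<notin> component A x" "b \<notin> component A x" by (metis component_eq_iff)+
      then have "X = component (insert {a, b} A) x" using x by (simp add: component_insert)
      then show ?thesis using x by (auto simp: components_def)
    qed
  qed
  \<comment> \<open>The union has to be a genuinely new set, as \<open>mset_set\<close> would not
    record a second insertion of an old one.\<close>
  have "?a \<union> ?b \<notin> components A - {?a, ?b}"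
  proof
    assume "?a \<union> ?b \<in> components A - {?a, ?b}"
    then obtain x where "?a \<union> ?b = component A x" "component A x \<noteq> ?a"
      unfolding components_def by blast
    moreover from this have "a \<in> component A x" by (metis UnI1 component_self)
    ultimately show False by (metis component_eq_iff)
  qed
  then have 1: "parts (insert {a, b} A) = add_mset (card (?a \<union> ?b)) (image_mset card (mset_set (components A - {?a, ?b})))"
    unfolding parts_def eq by simp
  have "card (?a \<union> ?b) = card ?a + card ?b"
    using A V disj by (intro card_Un_disjoint finite_component)
  moreover have "mset_set (components A) = add_mset ?a (add_mset ?b (mset_set (components A - {?a, ?b})))"
  proof -
    have "components A = insert ?a (insert ?b (components A - {?a, ?b}))"
      using V by (auto simp: components_def)
    then have "mset_set (components A) = mset_set (insert ?a (insert ?b (components A - {?a, ?b})))" by simp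
    also have "\<dots> = add_mset ?a (add_mset ?b (mset_set (components A - {?a, ?b})))"
      using ne by (simp del: insert_Diff_single)
    finally show ?thesis .
  qed
  ultimately show ?thesis using 1 by (simp add: parts_def)
qed

lemma parts_empty: "parts {} = replicate_mset (card V) 1"
proof -
  have c: "component {} u = {u}" for u :: 'a
    by (auto simp: component_def adj_def)
  have "components {} = (\<lambda>u. {u}) ` V" by (auto simp: components_def c)
  then have "mset_set (components {}) = image_mset (\<lambda>u. {u}) (mset_set V)"
    by (simp add: image_mset_mset_set)
  then show ?thesis by (simp add: parts_def multiset.map_comp comp_def image_mset_const_eq)
qed

text \<open>Each added edge removes one part and keeps the sum. Thus the number of edges, and with
  it the sign in the expansion, can be read off from the partition.\<close>

lemma size_and_sum_parts:
  assumes "A \<subseteq> E"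
  shows "size (parts A) + card A = card V \<and> sum_mset (parts A) = card V"
proof -
  have "finite A" using assms finite_E finite_subset by blast
  then show ?thesis using assms
  proof (induction A rule: finite_induct)
    case (insert e A)
    obtain a b where e: "e = {a, b}" using edgeE insert.prems by blast
    from parts_insert[of A a b] insert.prems insert.hyps e
    have eq: "parts (insert e A) + {#card (component A a), card (component A b)#} =
         parts A + {#card (component A a) + card (component A b)#}" by auto
    from arg_cong[OF eq, of size] arg_cong[OF eq, of sum_mset] insert show ?case by auto
  qed (simp add: parts_empty)
qed

lemma set_parts: "set_mset (parts A) = (\<lambda>v. card (component A v)) ` V"
proof -
  have "set_mset (parts A) = card ` components A" by (simp add: parts_def)
  then show ?thesis by (simp add: components_def image_image)
qed

lemma parts_pos:
  assumes "A \<subseteq> E" shows "0 \<notin># parts A"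
proof
  assume "0 \<in># parts A"
  then obtain u where "u \<in> V" "card (component A u) = 0" unfolding set_parts by auto
  then show False using finite_component[OF assms, of u] component_self[of u A] by auto
qed

section \<open>Edge sets without isolated vertices\<close>

definition covering :: "'a set set \<Rightarrow> bool" where
  "covering A \<longleftrightarrow> (\<forall>v\<in>V. \<exists>e\<in>A. v \<in> e)"

text \<open>A vertex avoids all edges of \<open>A\<close> exactly when its component is a singleton.
  Hence being a covering is visible in the partition alone.\<close>

lemma covering_iff_parts:
  assumes A: "A \<subseteq> E"
  shows "covering A \<longleftrightarrow> 1 \<notin># parts A"
proof -
  have "card (component A v) = 1 \<longleftrightarrow> (\<forall>e\<in>A. v \<notin> e)" if v: "v \<in> V" for v
  proof
    assume c: "card (component A v) = 1"
    show "\<forall>e\<in>A. v \<notin> e"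
    proof (intro ballI notI)
      fix e assume e: "e \<in> A" "v \<in> e"
      then obtain u where u: "e = {v, u}" "u \<noteq> v" using edgeE[of e] A by fastforce
      then have "u \<in> component A v" using e by (auto simp: component_def adj_def)
      moreover obtain x where "component A v = {x}" using c by (rule card_1_singletonE)
      ultimately show False using u component_self[of v A] by auto
    qed
  next
    assume "\<forall>e\<in>A. v \<notin> e"
    then have "component A v \<subseteq> {v}" by (intro component_least) auto
    then have "component A v = {v}" using component_self[of v A] by auto
    then show "card (component A v) = 1" by simp
  qed
  then show ?thesis unfolding covering_def set_parts image_iff by metis
qed

text \<open>A colouring that is constant on every edge of \<open>A\<close> is constant on
  components, hence amounts to a colouring of the components, in which a component of size
  \<open>k\<close> contributes the \<open>k\<close>-th power of its variable.\<close>

lemma colour_count_components: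
  assumes A: "A \<subseteq> E"
  shows "card {\<kappa> \<in> V \<rightarrow>\<^sub>E {1..}. (\<Sum>v\<in>V. Poly_Mapping.single (\<kappa> v) 1) = m \<and> (\<forall>e\<in>A. \<forall>x\<in>e. \<forall>y\<in>e. \<kappa> x = \<kappa> y)}
    = colour_count card (components A) m"
proof -
  let ?C = "components A" and ?c = "component A"
  let ?X = "{f \<in> ?C \<rightarrow>\<^sub>E {1..}. (\<Sum>B\<in>?C. Poly_Mapping.single (f B) (card B)) = m}"
  let ?Y = "{\<kappa> \<in> V \<rightarrow>\<^sub>E {1..}. (\<Sum>v\<in>V. Poly_Mapping.single (\<kappa> v) 1) = m \<and> (\<forall>e\<in>A. \<forall>x\<in>e. \<forall>y\<in>e. \<kappa> x = \<kappa> y)}"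
  \<comment> \<open>The inverse map reads the colour of a component at an arbitrary
    representative.\<close>
  let ?rep = "\<lambda>B. SOME v. v \<in> B"
  have rep: "?rep B \<in> B" "?c (?rep B) = B" "?rep B \<in> V" if B: "B \<in> ?C" for B
  proof -
    obtain u where u: "u \<in> V" "B = ?c u" using B by (auto simp: components_def)
    show r: "?rep B \<in> B" by (rule someI[of _ u]) (simp add: u)
    then show "?c (?rep B) = B" using u by (metis component_eq_iff)
    show "?rep B \<in> V" using r u component_subset[OF A] by auto
  qed
  have content: "(\<Sum>v\<in>V. Poly_Mapping.single (f (?c v)) 1) = (\<Sum>B\<in>?C. Poly_Mapping.single (f B) (card B))" for f :: "_ \<Rightarrow> nat"
  proof -
    have "(\<Sum>v\<in>V. Poly_Mapping.single (f (?c v)) (1::nat)) = (\<Sum>B\<in>?C. \<Sum>v\<in>{v\<in>V. ?c v = B}. Poly_Mapping.single (f (?c v)) 1)"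
      unfolding components_def using finite_V by (rule sum.image_gen)
    also have "\<dots> = (\<Sum>B\<in>?C. Poly_Mapping.single (f B) (card B))"
    proof (intro sum.cong refl)
      fix B assume "B \<in> ?C"
      then obtain u where u: "u \<in> V" "B = ?c u" by (auto simp: components_def)
      have BV: "B \<subseteq> V" using u component_subset[OF A] by auto
      have "{v\<in>V. ?c v = B} = B"
        unfolding u(2) using BV u by (auto simp: component_eq_iff component_sym)
      then have "(\<Sum>v\<in>{v\<in>V. ?c v = B}. Poly_Mapping.single (f (?c v)) (1::nat)) = (\<Sum>v\<in>B. Poly_Mapping.single (f B) 1)"
        by (intro sum.cong) auto
      also have "\<dots> = Poly_Mapping.single (f B) (card B)"
        using BV finite_V finite_subset by (intro sum_single_const) blast
      finally show "(\<Sum>v\<in>{v\<in>V. ?c v = B}. Poly_Mapping.single (f (?c v)) (1::nat)) = Poly_Mapping.single (f B) (card B)" .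
    qed
    finally show ?thesis .
  qed
  have const: "\<kappa> u = \<kappa> v" if k: "\<forall>e\<in>A. \<forall>x\<in>e. \<forall>y\<in>e. \<kappa> x = \<kappa> y" and uv: "v \<in> ?c u" for \<kappa> :: "'a \<Rightarrow> nat" and u v
  proof -
    have "?c u \<subseteq> {x. \<kappa> x = \<kappa> u}"
    proof (rule component_least)
      fix x y assume x: "x \<in> {x. \<kappa> x = \<kappa> u}" and xy: "{x, y} \<in> A"
      have "\<kappa> x = \<kappa> y" by (rule k[rule_format, OF xy]) simp_all
      with x show "y \<in> {x. \<kappa> x = \<kappa> u}" by simp
    qed simp
    then show ?thesis using uv by auto
  qed
  have inV: "?c v \<in> ?C" if "v \<in> V" for v using that by (auto simp: components_def)
  have "bij_betw (\<lambda>f. restrict (\<lambda>v. f (?c v)) V) ?X ?Y"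
  proof (rule bij_betw_byWitness[where f' = "\<lambda>\<kappa>. restrict (\<lambda>B. \<kappa> (?rep B)) ?C"])
    show "\<forall>f\<in>?X. restrict (\<lambda>B. restrict (\<lambda>v. f (?c v)) V (?rep B)) ?C = f"
    proof (intro ballI ext)
      fix f B assume "f \<in> ?X"
      then have "f \<in> extensional ?C" unfolding PiE_def by blast
      then show "restrict (\<lambda>B. restrict (\<lambda>v. f (?c v)) V (?rep B)) ?C B = f B"
        by (cases "B \<in> ?C") (simp_all add: rep extensional_arb[of f ?C])
    qed
    show "\<forall>\<kappa>\<in>?Y. restrict (\<lambda>v. restrict (\<lambda>B. \<kappa> (?rep B)) ?C (?c v)) V = \<kappa>"
    proof (intro ballI ext)
      fix \<kappa> v assume k: "\<kappa> \<in> ?Y"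
      then have kk: "\<forall>e\<in>A. \<forall>x\<in>e. \<forall>y\<in>e. \<kappa> x = \<kappa> y" by blast
      have "\<kappa> \<in> extensional V" using k unfolding PiE_def by blast
      moreover have "\<kappa> (?rep (?c v)) = \<kappa> v" if "v \<in> V"
        by (rule const[OF kk rep(1)[OF inV[OF that]], symmetric])
      ultimately show "restrict (\<lambda>v. restrict (\<lambda>B. \<kappa> (?rep B)) ?C (?c v)) V v = \<kappa> v"
        by (cases "v \<in> V") (simp_all add: inV extensional_arb[of \<kappa> V])
    qed
    show "(\<lambda>f. restrict (\<lambda>v. f (?c v)) V) ` ?X \<subseteq> ?Y"
    proof (intro image_subsetI)
      fix f assume f: "f \<in> ?X"
      let ?k = "restrict (\<lambda>v. f (?c v)) V"
      have "?k \<in> V \<rightarrow>\<^sub>E {1..}" using f inV by (auto simp: PiE_def Pi_def)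
      moreover have "(\<Sum>v\<in>V. Poly_Mapping.single (?k v) 1) = m"
      proof -
        have "(\<Sum>v\<in>V. Poly_Mapping.single (?k v) (1::nat)) = (\<Sum>v\<in>V. Poly_Mapping.single (f (?c v)) 1)"
          by (intro sum.cong) simp_all
        also have "\<dots> = (\<Sum>B\<in>?C. Poly_Mapping.single (f B) (card B))" by (rule content)
        also have "\<dots> = m" using f by blast
        finally show ?thesis .
      qed
      moreover have "?k x = ?k y" if e: "e \<in> A" "x \<in> e" "y \<in> e" for e x y
      proof -
        obtain a b where ab: "e = {a, b}" "a \<in> V" "b \<in> V" using edgeE A e by blast
        then have "(a, b) \<in> adj A" using e by (auto simp: adj_def)
        then have "?c a = ?c b" unfolding component_eq_iff by (auto simp: component_def)
        then show ?thesis using ab e by auto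
      qed
      ultimately show "?k \<in> ?Y" by blast
    qed
    show "(\<lambda>\<kappa>. restrict (\<lambda>B. \<kappa> (?rep B)) ?C) ` ?Y \<subseteq> ?X"
    proof (intro image_subsetI)
      fix \<kappa> assume k: "\<kappa> \<in> ?Y"
      then have kk: "\<forall>e\<in>A. \<forall>x\<in>e. \<forall>y\<in>e. \<kappa> x = \<kappa> y" and kP: "\<kappa> \<in> V \<rightarrow>\<^sub>E {1..}" by blast+
      let ?f = "restrict (\<lambda>B. \<kappa> (?rep B)) ?C"
      have "?f \<in> ?C \<rightarrow>\<^sub>E {1..}" using kP rep by (auto simp: PiE_def Pi_def)
      moreover have "(\<Sum>B\<in>?C. Poly_Mapping.single (?f B) (card B)) = m"
      proof -
        have "(\<Sum>B\<in>?C. Poly_Mapping.single (?f B) (card B)) = (\<Sum>v\<in>V. Poly_Mapping.single (?f (?c v)) 1)"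
          by (rule content[symmetric])
        also have "\<dots> = (\<Sum>v\<in>V. Poly_Mapping.single (\<kappa> v) 1)"
        proof (intro sum.cong refl)
          fix v assume v: "v \<in> V"
          have "\<kappa> (?rep (?c v)) = \<kappa> v"
            by (rule const[OF kk rep(1)[OF inV[OF v]], symmetric])
          then show "Poly_Mapping.single (?f (?c v)) (1::nat) = Poly_Mapping.single (\<kappa> v) 1"
            using inV[OF v] by simp
        qed
        also have "\<dots> = m" using k by blast
        finally show ?thesis .
      qed
      ultimately show "?f \<in> ?X" by blast
    qed
  qed
  then show ?thesis unfolding colour_count_def by (rule bij_betw_same_card[symmetric])
qed

text \<open>Inclusion-exclusion: for each colouring the indicator of having no monochromatic edge is
  an alternating sum over sets of monochromatic edges. After the two sums are swapped, each edge set
  contributes the colourings that are constant on its components.\<close>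

lemma proper_colouring_count:
  "int (card {\<kappa> \<in> V \<rightarrow>\<^sub>E {1..}. (\<Sum>v\<in>V. Poly_Mapping.single (\<kappa> v) 1) = m \<and> (\<forall>e\<in>E. \<exists>x\<in>e. \<exists>y\<in>e. \<kappa> x \<noteq> \<kappa> y)})
    = (\<Sum>A\<in>Pow E. (-1) ^ card A * int (power_sum_coeff (parts A) m))"
proof -
  let ?K = "{\<kappa> \<in> V \<rightarrow>\<^sub>E {1..}. (\<Sum>v\<in>V. Poly_Mapping.single (\<kappa> v) 1) = m}"
  let ?M = "\<lambda>\<kappa> :: 'a \<Rightarrow> nat. {e \<in> E. \<forall>x\<in>e. \<forall>y\<in>e. \<kappa> x = \<kappa> y}"
  \<comment> \<open>Only variables occurring in \<open>m\<close> can be used as colours. Finiteness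
    lets \<open>card\<close> be rewritten as a sum over \<open>?K\<close>.\<close>
  have finK: "finite ?K"
  proof (rule finite_subset)
    show "?K \<subseteq> V \<rightarrow>\<^sub>E Poly_Mapping.keys m"
    proof
      fix \<kappa> assume k: "\<kappa> \<in> ?K"
      have "\<kappa> v \<in> Poly_Mapping.keys m" if "v \<in> V" for v
      proof -
        have m: "m = (\<Sum>v\<in>V. Poly_Mapping.single (\<kappa> v) 1)" using k by simp
        show ?thesis
          unfolding in_keys_iff m lookup_sum lookup_single sum_eq_0_iff[OF finite_V]
            using that by (metis one_neq_zero when_simps(1))
      qed
      then show "\<kappa> \<in> V \<rightarrow>\<^sub>E Poly_Mapping.keys m" using k unfolding PiE_def Pi_def by blast
    qed
  qed (use finite_V in \<open>auto intro: finite_PiE\<close>)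
  have "{\<kappa> \<in> V \<rightarrow>\<^sub>E {1..}. (\<Sum>v\<in>V. Poly_Mapping.single (\<kappa> v) 1) = m \<and> (\<forall>e\<in>E. \<exists>x\<in>e. \<exists>y\<in>e. \<kappa> x \<noteq> \<kappa> y)}
      = {\<kappa> \<in> ?K. ?M \<kappa> = {}}" by blast
  then have "int (card {\<kappa> \<in> V \<rightarrow>\<^sub>E {1..}. (\<Sum>v\<in>V. Poly_Mapping.single (\<kappa> v) 1) = m \<and> (\<forall>e\<in>E. \<exists>x\<in>e. \<exists>y\<in>e. \<kappa> x \<noteq> \<kappa> y)})
      = (\<Sum>\<kappa>\<in>?K. if ?M \<kappa> = {} then 1 else 0)"
    using finK by (simp add: sum.If_cases Int_def)
  also have "\<dots> = (\<Sum>\<kappa>\<in>?K. \<Sum>A\<in>Pow (?M \<kappa>). (-1) ^ card A)"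
    using finite_E by (intro sum.cong refl) (simp add: sum_Pow_neg_one)
  also have "\<dots> = (\<Sum>\<kappa>\<in>?K. \<Sum>A\<in>Pow E. if A \<subseteq> ?M \<kappa> then (-1) ^ card A else 0)"
    using finite_E by (intro sum.cong refl sum.mono_neutral_cong_left) auto
  also have "\<dots> = (\<Sum>A\<in>Pow E. \<Sum>\<kappa>\<in>?K. if A \<subseteq> ?M \<kappa> then (-1) ^ card A else 0)"
    by (rule sum.swap)
  also have "\<dots> = (\<Sum>A\<in>Pow E. (-1) ^ card A * int (power_sum_coeff (parts A) m))"
  proof (intro sum.cong refl)
    fix A assume "A \<in> Pow E"
    then have A: "A \<subseteq> E" by simp
    have "(\<Sum>\<kappa>\<in>?K. if A \<subseteq> ?M \<kappa> then (-1) ^ card A else 0 :: int) = (-1) ^ card A * int (card {\<kappa> \<in> ?K. A \<subseteq> ?M \<kappa>})"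
      using finK by (simp add: sum.If_cases Int_def)
    also have "{\<kappa> \<in> ?K. A \<subseteq> ?M \<kappa>} = {\<kappa> \<in> V \<rightarrow>\<^sub>E {1..}. (\<Sum>v\<in>V. Poly_Mapping.single (\<kappa> v) 1) = m \<and> (\<forall>e\<in>A. \<forall>x\<in>e. \<forall>y\<in>e. \<kappa> x = \<kappa> y)}"
      using A by blast
    also have "card \<dots> = power_sum_coeff (parts A) m"
      unfolding colour_count_components[OF A] parts_def by (simp add: colour_count_eq_power_sum_coeff)
    finally show "(\<Sum>\<kappa>\<in>?K. if A \<subseteq> ?M \<kappa> then (-1) ^ card A else 0) = (-1) ^ card A * int (power_sum_coeff (parts A) m)" .
  qed
  finally show ?thesis .
qed

definition types :: "nat multiset multiset" where
  "types = image_mset parts (mset_set (Pow E))"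

text \<open>For a forest the parity of \<open>card A\<close> can be read off from the type of \<open>A\<close>.\<close>

lemma proper_colouring_count_types:
  "int (card {\<kappa> \<in> V \<rightarrow>\<^sub>E {1..}. (\<Sum>v\<in>V. Poly_Mapping.single (\<kappa> v) 1) = m \<and> (\<forall>e\<in>E. \<exists>x\<in>e. \<exists>y\<in>e. \<kappa> x \<noteq> \<kappa> y)})
    = (\<Sum>\<mu>\<in>#types. (-1) ^ (sum_mset \<mu> + size \<mu>) * int (power_sum_coeff \<mu> m))"
proof -
  have "(-1) ^ card A = ((-1) ^ (sum_mset (parts A) + size (parts A)) :: int)" if "A \<in> Pow E" for A
  proof -
    have "sum_mset (parts A) + size (parts A) = 2 * size (parts A) + card A"
      using size_and_sum_parts[of A] that by auto
    then show ?thesis by (simp add: power_add)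
  qed
  then show ?thesis
    unfolding proper_colouring_count types_def
    by (simp add: multiset.map_comp comp_def sum_unfold_sum_mset cong: image_mset_cong)
qed

end

section \<open>The weighted core\<close>

context edge_tree
begin

definition leaf :: "'a \<Rightarrow> bool" where
  "leaf v \<longleftrightarrow> v \<in> V \<and> (\<exists>!e. e \<in> E \<and> v \<in> e)"

definition leaf_edges :: "'a set set" where
  "leaf_edges = {e \<in> E. \<exists>v\<in>e. leaf v}"

definition core :: "'a set" where
  "core = {v \<in> V. \<not> leaf v}"

definition leaves_at :: "'a \<Rightarrow> 'a set" where
  "leaves_at v = {u. leaf u \<and> {u, v} \<in> E}"

text \<open>Defined as a component size so that the weights are the parts of
  \<open>leaf_edges\<close> by construction; \<open>weight_core\<close> identifies it with one plus
  the number of adjacent leaves on the core.\<close>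

definition weight :: "'a \<Rightarrow> nat" where
  "weight v = card (component leaf_edges v)"

lemma leaf_edges_subset: "leaf_edges \<subseteq> E"
  by (auto simp: leaf_edges_def)

lemma finite_core: "finite core"
  by (simp add: core_def finite_V)

lemma finite_leaves_at: "finite (leaves_at v)"
  by (rule finite_subset[OF _ finite_V]) (auto simp: leaves_at_def leaf_def)

lemma leaf_neighbour_unique:
  assumes "leaf u" and "{u, v} \<in> E" and "{u, w} \<in> E"
  shows "v = w"
proof -
  from assms have "{u, v} = {u, w}" unfolding leaf_def by blast
  then show ?thesis by (auto simp: doubleton_eq_iff)
qed

lemma leaf_neighbour_ex:
  assumes "leaf u" obtains v where "{u, v} \<in> E"
proof -
  obtain e where e: "e \<in> E" "u \<in> e" using assms unfolding leaf_def by blast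
  with edgeE[OF e(1)] obtain v where "e = {u, v}" by auto
  with e that show ?thesis by blast
qed

lemma edge_ex:
  assumes "2 \<le> card V" and "v \<in> V"
  obtains e where "e \<in> E" "v \<in> e"
proof -
  have "\<exists>e\<in>E. v \<in> e"
  proof (rule ccontr)
    assume "\<not> (\<exists>e\<in>E. v \<in> e)"
    then have "component E v \<subseteq> {v}" by (intro component_least) auto
    then have "V \<subseteq> {v}" using connected[OF assms(2)] by simp
    then have "card V \<le> 1" using card_mono[of "{v}" V] by simp
    then show False using assms(1) by simp
  qed
  then show ?thesis using that by blast
qed

text \<open>Two adjacent leaves are closed under all edges, so by connectedness they would be the
  whole tree.\<close>

lemma leaf_neighbour_not_leaf:
  assumes "3 \<le> card V" and "leaf u" and "{u, v} \<in> E"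
  shows "\<not> leaf v"
proof
  assume "leaf v"
  have vu: "{v, u} \<in> E" using assms(3) by (simp add: insert_commute)
  have "component E u \<subseteq> {u, v}"
  proof (rule component_least)
    fix x y assume "x \<in> {u, v}" "{x, y} \<in> E"
    then show "y \<in> {u, v}"
      using leaf_neighbour_unique[OF assms(2,3)] leaf_neighbour_unique[OF \<open>leaf v\<close> vu] by blast
  qed simp
  then have "V \<subseteq> {u, v}" using connected assms(2) unfolding leaf_def by blast
  then have "card V \<le> card {u, v}" by (intro card_mono) auto
  also have "\<dots> \<le> 2" by (simp add: card_insert_if)
  finally show False using assms(1) by simp
qed

text \<open>This is what allows \<open>E - leaf_edges\<close> to stand for the edge set of the core
  from here on.\<close>

lemma core_edge_iff:
  "{u, v} \<in> E - leaf_edges \<longleftrightarrow> {u, v} \<in> E \<and> u \<in> core \<and> v \<in> core"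
  using edge_in_V[of u v] by (auto simp: leaf_edges_def core_def)

lemma core_edgeE:
  assumes "e \<in> E - leaf_edges"
  obtains u v where "e = {u, v}" "u \<noteq> v" "u \<in> core" "v \<in> core"
proof -
  obtain u v where uv: "e = {u, v}" "u \<noteq> v" using edgeE assms by blast
  then show ?thesis using that core_edge_iff[of u v] assms by blast
qed

text \<open>The leaf edges at a core vertex form a star: a leaf has no other neighbour than its
  centre, and a leaf edge at the centre leads to a leaf.\<close>

lemma component_leaf_edges:
  assumes "v \<in> core"
  shows "component leaf_edges v = insert v (leaves_at v)"
proof
  show "component leaf_edges v \<subseteq> insert v (leaves_at v)"
  proof (rule component_least)
    fix x y assume x: "x \<in> insert v (leaves_at v)" and xy: "{x, y} \<in> leaf_edges"
    show "y \<in> insert v (leaves_at v)"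
    proof (cases "x = v")
      case True
      then have "leaf y" using xy assms by (auto simp: leaf_edges_def core_def)
      then show ?thesis using xy True by (auto simp: leaf_edges_def leaves_at_def insert_commute)
    next
      case False
      then have "leaf x" "{x, v} \<in> E" using x by (auto simp: leaves_at_def)
      then have "y = v" using leaf_neighbour_unique[of x y v] xy leaf_edges_subset by blast
      then show ?thesis by simp
    qed
  qed simp
  have "u \<in> component leaf_edges v" if "u \<in> leaves_at v" for u
  proof -
    have "{v, u} \<in> leaf_edges" using that by (auto simp: leaves_at_def leaf_edges_def insert_commute)
    then show ?thesis by (auto simp: component_def adj_def)
  qed
  then show "insert v (leaves_at v) \<subseteq> component leaf_edges v" by auto
qed

lemma weight_core:
  assumes "v \<in> core"
  shows "weight v = 1 + card (leaves_at v)"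
proof -
  have "v \<notin> leaves_at v" using assms by (simp add: leaves_at_def core_def)
  then show ?thesis
    unfolding weight_def component_leaf_edges[OF assms] by (simp add: finite_leaves_at)
qed

text \<open>Every component of the leaf edges contains exactly one core vertex. With at least three
  vertices the neighbour of a leaf is in the core, so no component consists of leaves only.\<close>

lemma parts_leaf_edges:
  assumes "3 \<le> card V"
  shows "parts leaf_edges = image_mset weight (mset_set core)"
proof -
  let ?c = "component leaf_edges"
  have "inj_on ?c core"
  proof (rule inj_onI)
    fix u v assume uv: "u \<in> core" "v \<in> core" "?c u = ?c v"
    then have "u \<in> ?c v" by (metis component_self)
    then show "u = v" using uv(1,2) by (simp add: component_leaf_edges leaves_at_def core_def)
  qed
  moreover have "components leaf_edges = ?c ` core"
  proof
    show "?c ` core \<subseteq> components leaf_edges" by (auto simp: components_def core_def)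
    show "components leaf_edges \<subseteq> ?c ` core"
    proof
      fix X assume "X \<in> components leaf_edges"
      then obtain u where u: "u \<in> V" "X = ?c u" by (auto simp: components_def)
      show "X \<in> ?c ` core"
      proof (cases "leaf u")
        case True
        then obtain v where v: "{u, v} \<in> E" by (rule leaf_neighbour_ex)
        have vc: "v \<in> core"
          using leaf_neighbour_not_leaf[OF assms True v] edge_in_V[OF v] by (simp add: core_def)
        have "u \<in> ?c v" unfolding component_leaf_edges[OF vc] using True v by (simp add: leaves_at_def)
        then have "?c v = ?c u" by (simp add: component_eq_iff)
        then show ?thesis using u vc by blast
      qed (use u in \<open>auto simp: core_def\<close>)
    qed
  qed
  ultimately have "mset_set (components leaf_edges) = image_mset ?c (mset_set core)"
    by (simp add: image_mset_mset_set)
  then show ?thesis by (simp add: parts_def multiset.map_comp comp_def weight_def[abs_def])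
qed

lemma leaf_edges_subset_covering:
  assumes "A \<subseteq> E" and "covering A"
  shows "leaf_edges \<subseteq> A"
proof
  fix e assume "e \<in> leaf_edges"
  then obtain v where v: "v \<in> e" "leaf v" "e \<in> E" by (auto simp: leaf_edges_def)
  moreover from this obtain e' where "e' \<in> A" "v \<in> e'" using assms(2) by (auto simp: covering_def leaf_def)
  ultimately have "e = e'" using assms(1) unfolding leaf_def by blast
  then show "e \<in> A" using \<open>e' \<in> A\<close> by simp
qed

lemma covering_mono: "covering A \<Longrightarrow> A \<subseteq> B \<Longrightarrow> covering B"
  unfolding covering_def by blast

text \<open>If \<open>e\<close> is not a leaf edge, a leaf keeps its only edge and any other vertex
  has a second edge to fall back on.\<close>

lemma covering_remove_edge:
  assumes "2 \<le> card V" and "e \<in> E"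
  shows "covering (E - {e}) \<longleftrightarrow> e \<notin> leaf_edges"
proof
  assume "covering (E - {e})"
  then show "e \<notin> leaf_edges" using leaf_edges_subset_covering[of "E - {e}"] by blast
next
  assume e: "e \<notin> leaf_edges"
  show "covering (E - {e})"
    unfolding covering_def
  proof
    fix v assume v: "v \<in> V"
    obtain f where f: "f \<in> E" "v \<in> f" using edge_ex[OF assms(1) v] .
    show "\<exists>f\<in>E - {e}. v \<in> f"
    proof (cases "leaf v")
      case True
      then have "f \<in> leaf_edges" using f by (auto simp: leaf_edges_def)
      then show ?thesis using f e by blast
    next
      case False
      then obtain g where "g \<in> E" "v \<in> g" "g \<noteq> f" using f v unfolding leaf_def by blast
      then show ?thesis using f by blast
    qed
  qed
qed

section \<open>Counting core edges through coverings with two parts\<close>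

lemma card_E:
  assumes "V \<noteq> {}"
  shows "card E + 1 = card V"
proof -
  have "components E = {V}" using assms connected by (auto simp: components_def)
  then have "size (parts E) = 1" by (simp add: parts_def)
  then show ?thesis using size_and_sum_parts[of E] by simp
qed

text \<open>Two parts mean that exactly one edge is missing, and the rest is a covering precisely
  when that edge is a core edge. Properness is not assumed, so the count also applies to the tree
  that is only known through its partitions.\<close>

lemma card_coverings_two_parts:
  assumes "3 \<le> card V"
  shows "card {A \<in> Pow E. covering A \<and> size (parts A) = 2} = card (E - leaf_edges)"
proof -
  have "V \<noteq> {}" using assms by auto
  have "{A \<in> Pow E. covering A \<and> size (parts A) = 2} = (\<lambda>e. E - {e}) ` (E - leaf_edges)"
  proof (intro equalityI subsetI)
    fix A assume "A \<in> {A \<in> Pow E. covering A \<and> size (parts A) = 2}"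
    then have A: "A \<subseteq> E" "covering A" "size (parts A) = 2" by auto
    then have "card E = card A + 1" using size_and_sum_parts[of A] card_E[OF \<open>V \<noteq> {}\<close>] by simp
    then have "card (E - A) = 1" using A(1) finite_E by (simp add: card_Diff_subset finite_subset)
    then obtain e where e: "E - A = {e}" by (rule card_1_singletonE)
    then have "A = E - {e}" "e \<in> E" using A(1) by auto
    then show "A \<in> (\<lambda>e. E - {e}) ` (E - leaf_edges)"
      using covering_remove_edge[of e] A(2) assms by auto
  next
    fix A assume "A \<in> (\<lambda>e. E - {e}) ` (E - leaf_edges)"
    then obtain e where e: "A = E - {e}" "e \<in> E" "e \<notin> leaf_edges" by auto
    then have "card E = card A + 1" using finite_E by (metis Suc_eq_plus1 card_Suc_Diff1)
    moreover have "A \<subseteq> E" using e by blast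
    ultimately have "size (parts A) = 2" using size_and_sum_parts[of A] card_E[OF \<open>V \<noteq> {}\<close>] by simp
    then show "A \<in> {A \<in> Pow E. covering A \<and> size (parts A) = 2}"
      using covering_remove_edge[of e] assms e by auto
  qed
  moreover have "inj_on (\<lambda>e. E - {e}) (E - leaf_edges)" by (auto simp: inj_on_def)
  ultimately show ?thesis by (simp add: card_image)
qed

text \<open>Otherwise \<open>v\<close> and its leaves would be closed under all edges, and
  \<open>v\<close> would be the only core vertex.\<close>

lemma core_edge_ex:
  assumes "3 \<le> card V" and "2 \<le> card core" and "v \<in> core"
  obtains e where "e \<in> E - leaf_edges" "v \<in> e"
proof -
  have "\<exists>e\<in>E - leaf_edges. v \<in> e"
  proof (rule ccontr)
    assume no: "\<not> (\<exists>e\<in>E - leaf_edges. v \<in> e)"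
    have "component E v \<subseteq> insert v (leaves_at v)"
    proof (rule component_least)
      fix x y assume x: "x \<in> insert v (leaves_at v)" and xy: "{x, y} \<in> E"
      show "y \<in> insert v (leaves_at v)"
      proof (cases "x = v")
        case True
        then have "{v, y} \<in> leaf_edges" using xy no by blast
        then have "leaf y" using assms(3) by (auto simp: leaf_edges_def core_def)
        then show ?thesis using xy True by (simp add: leaves_at_def insert_commute)
      next
        case False
        then show ?thesis using x xy leaf_neighbour_unique[of x y v] by (auto simp: leaves_at_def)
      qed
    qed simp
    then have "V \<subseteq> insert v (leaves_at v)" using connected assms(3) by (auto simp: core_def)
    then have "core \<subseteq> {v}" by (auto simp: core_def leaves_at_def)
    then have "card core \<le> 1" using card_mono[of "{v}" core] by simp
    then show False using assms(2) by simp
  qed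
  then show ?thesis using that by blast
qed

lemma parts_insert_core_edge:
  assumes "{u, v} \<in> E - leaf_edges"
  shows "parts (insert {u, v} leaf_edges) + {#weight u, weight v#} =
         parts leaf_edges + {#weight u + weight v#}"
  using parts_insert[OF leaf_edges_subset assms] by (simp add: weight_def)

lemma weight_pos: "v \<in> V \<Longrightarrow> weight v > 0"
  using finite_component[OF leaf_edges_subset, of v] component_self[of v leaf_edges]
  unfolding weight_def card_gt_0_iff by blast

text \<open>Two adjacent core vertices of core degree one would make up the whole core.\<close>

lemma core_edge_degree:
  assumes "3 \<le> card core" and uv: "{u, v} \<in> E - leaf_edges"
  obtains x y z where "x \<in> {u, v}" "y \<noteq> z" "{x, y} \<in> E - leaf_edges" "{x, z} \<in> E - leaf_edges"
proof (rule ccontr)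
  assume "\<not> thesis"
  with that have deg: "y = z" if "x \<in> {u, v}" "{x, y} \<in> E - leaf_edges" "{x, z} \<in> E - leaf_edges" for x y z
    using that by blast
  have core: "u \<in> core" "v \<in> core" and vu: "{v, u} \<in> E - leaf_edges"
    using uv core_edge_iff[of u v] by (auto simp: insert_commute)
  let ?S = "{u, v} \<union> leaves_at u \<union> leaves_at v"
  have "component E u \<subseteq> ?S"
  proof (rule component_least)
    fix x y assume x: "x \<in> ?S" and xy: "{x, y} \<in> E"
    show "y \<in> ?S"
    proof (cases "x \<in> {u, v}")
      case True
      show ?thesis
      proof (cases "leaf y")
        case True
        then show ?thesis using xy \<open>x \<in> {u, v}\<close> by (auto simp: leaves_at_def insert_commute)
      next
        case False
        then have "y \<in> core" using edge_in_V[OF xy] by (simp add: core_def)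
        then have "{x, y} \<in> E - leaf_edges" using xy True core core_edge_iff[of x y] by blast
        then show ?thesis using deg[OF True, of y] True uv vu by blast
      qed
    next
      case False
      then have "leaf x" "{x, u} \<in> E \<or> {x, v} \<in> E" using x by (auto simp: leaves_at_def)
      then show ?thesis using leaf_neighbour_unique[OF \<open>leaf x\<close> xy] by blast
    qed
  qed simp
  then have "V \<subseteq> ?S" using connected core by (auto simp: core_def)
  then have "core \<subseteq> {u, v}" by (auto simp: core_def leaves_at_def)
  then have "card core \<le> card {u, v}" by (intro card_mono) auto
  also have "\<dots> \<le> 2" by (simp add: card_insert_if)
  finally show False using assms(1) by simp
qed

end

section \<open>Reconstruction\<close>

text \<open>Properness is assumed for the first tree only, in the form that the leaf edges leave no
  vertex isolated; for the second tree it is derived from the equality of the partition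
  multisets.\<close>

locale tree_pair = T: edge_tree V E + S: edge_tree V' E'
  for V :: "'a set" and E and V' :: "'c set" and E' +
  assumes types_eq: "T.types = S.types"
    and card_V: "3 \<le> card V"
    and proper: "T.covering T.leaf_edges"
begin

text \<open>The bijection is an arbitrary matching by partitions and need not respect inclusion.
  Structure is recovered below, for the leaf edges and for the leaf edges with one edge
  added.\<close>

lemma edge_set_bij:
  obtains \<beta> where "bij_betw \<beta> (Pow E) (Pow E')"
    and "\<And>A. A \<subseteq> E \<Longrightarrow> S.parts (\<beta> A) = T.parts A"
  using bij_if_image_mset_eq[of "Pow E" "Pow E'" T.parts S.parts] types_eq T.finite_E S.finite_E
  unfolding T.types_def S.types_def by (metis Pow_iff finite_Pow_iff)

lemma bij_betw_parts:
  assumes b: "bij_betw \<beta> (Pow E) (Pow E')"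
    and p: "\<And>A. A \<subseteq> E \<Longrightarrow> S.parts (\<beta> A) = T.parts A"
  shows "bij_betw \<beta> {A \<in> Pow E. P (T.parts A)} {A \<in> Pow E'. P (S.parts A)}"
proof -
  have "\<beta> ` {A \<in> Pow E. P (T.parts A)} = {A \<in> Pow E'. P (S.parts A)}"
  proof (intro equalityI subsetI)
    fix B assume "B \<in> {A \<in> Pow E'. P (S.parts A)}"
    moreover from this obtain A where "A \<in> Pow E" "B = \<beta> A" using b unfolding bij_betw_def by blast
    ultimately show "B \<in> \<beta> ` {A \<in> Pow E. P (T.parts A)}" using p by auto
  qed (use b p in \<open>auto simp: bij_betw_def\<close>)
  moreover have "inj_on \<beta> {A \<in> Pow E. P (T.parts A)}"
    using b unfolding bij_betw_def by (auto intro: inj_on_subset)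
  ultimately show ?thesis by (simp add: bij_betw_def)
qed

lemma card_V_eq: "card V' = card V"
proof -
  obtain \<beta> where "bij_betw \<beta> (Pow E) (Pow E')" and "\<And>A. A \<subseteq> E \<Longrightarrow> S.parts (\<beta> A) = T.parts A"
    using edge_set_bij by blast
  then have "\<beta> {} \<subseteq> E'" "S.parts (\<beta> {}) = T.parts {}" by (auto simp: bij_betw_def)
  then show ?thesis using S.size_and_sum_parts[of "\<beta> {}"] T.size_and_sum_parts[of "{}"] by simp
qed

lemma card_V': "3 \<le> card V'"
  using card_V card_V_eq by simp

lemma card_E_eq: "card E' = card E"
proof -
  have "V \<noteq> {}" "V' \<noteq> {}" using card_V card_V' by auto
  then show ?thesis using T.card_E S.card_E card_V_eq by simp
qed

text \<open>Being a covering with two parts is a condition on the partition, so the matching of edge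
  sets preserves it.\<close>

lemma card_core_edges_eq: "card (E' - S.leaf_edges) = card (E - T.leaf_edges)"
proof -
  obtain \<beta> where b: "bij_betw \<beta> (Pow E) (Pow E')" and p: "\<And>A. A \<subseteq> E \<Longrightarrow> S.parts (\<beta> A) = T.parts A"
    using edge_set_bij by blast
  have "card {A \<in> Pow E. T.covering A \<and> size (T.parts A) = 2} = card {A \<in> Pow E'. S.covering A \<and> size (S.parts A) = 2}"
    using bij_betw_parts[OF b p, of "\<lambda>\<mu>. 1 \<notin># \<mu> \<and> size \<mu> = 2"] T.covering_iff_parts S.covering_iff_parts
    by (auto dest!: bij_betw_same_card cong: conj_cong)
  then show ?thesis
    using T.card_coverings_two_parts[OF card_V] S.card_coverings_two_parts[OF card_V'] by simp
qed

lemma card_leaf_edges_eq: "card S.leaf_edges = card T.leaf_edges"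
proof -
  have "card (E - T.leaf_edges) = card E - card T.leaf_edges"
    using T.leaf_edges_subset T.finite_E by (meson card_Diff_subset finite_subset)
  moreover have "card (E' - S.leaf_edges) = card E' - card S.leaf_edges"
    using S.leaf_edges_subset S.finite_E by (meson card_Diff_subset finite_subset)
  moreover have "card T.leaf_edges \<le> card E" "card S.leaf_edges \<le> card E'"
    using T.leaf_edges_subset T.finite_E S.leaf_edges_subset S.finite_E by (auto intro: card_mono)
  ultimately show ?thesis using card_core_edges_eq card_E_eq by simp
qed

lemma card_eq_parts:
  assumes "A \<subseteq> E" and "B \<subseteq> E'" and "S.parts B = T.parts A"
  shows "card B = card A"
  using assms T.size_and_sum_parts[of A] S.size_and_sum_parts[of B] card_V_eq by simp

text \<open>The image has no part 1, so it is a covering and contains all leaf edges of the second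
  tree; equal cardinalities leave no room for more. In particular the second tree is proper.\<close>

lemma image_leaf_edges:
  assumes b: "bij_betw \<beta> (Pow E) (Pow E')"
    and p: "\<And>A. A \<subseteq> E \<Longrightarrow> S.parts (\<beta> A) = T.parts A"
  shows "\<beta> T.leaf_edges = S.leaf_edges"
proof -
  have sub: "\<beta> T.leaf_edges \<subseteq> E'"
    using b T.leaf_edges_subset unfolding bij_betw_def by blast
  have "S.covering (\<beta> T.leaf_edges)"
    using S.covering_iff_parts[OF sub] T.covering_iff_parts[OF T.leaf_edges_subset] p[OF T.leaf_edges_subset] proper by simp
  then have "S.leaf_edges \<subseteq> \<beta> T.leaf_edges" by (rule S.leaf_edges_subset_covering[OF sub])
  moreover have "card (\<beta> T.leaf_edges) = card S.leaf_edges"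
    using card_eq_parts[OF T.leaf_edges_subset sub p[OF T.leaf_edges_subset]] card_leaf_edges_eq by simp
  ultimately show ?thesis
    using card_subset_eq[of "\<beta> T.leaf_edges" S.leaf_edges] sub S.finite_E finite_subset by metis
qed

lemma parts_leaf_edges_eq: "S.parts S.leaf_edges = T.parts T.leaf_edges"
  using edge_set_bij image_leaf_edges T.leaf_edges_subset by metis

lemma weights_eq: "image_mset S.weight (mset_set S.core) = image_mset T.weight (mset_set T.core)"
  using parts_leaf_edges_eq T.parts_leaf_edges[OF card_V] S.parts_leaf_edges[OF card_V'] by simp

lemma card_core_eq: "card S.core = card T.core"
  using arg_cong[OF weights_eq, of size] by simp

text \<open>Adding a core edge to the leaf edges keeps the covering property, so the image is a
  covering with one edge more than the leaf edges of the second tree. That extra edge is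
  \<open>\<gamma> e\<close>. Injectivity is inherited from \<open>\<beta>\<close>, and surjectivity
  follows by counting core edges.\<close>

lemma core_edge_bij:
  obtains \<gamma> where "bij_betw \<gamma> (E - T.leaf_edges) (E' - S.leaf_edges)"
    and "\<And>e. e \<in> E - T.leaf_edges \<Longrightarrow>
      S.parts (insert (\<gamma> e) S.leaf_edges) = T.parts (insert e T.leaf_edges)"
proof -
  obtain \<beta> where b: "bij_betw \<beta> (Pow E) (Pow E')" and p: "\<And>A. A \<subseteq> E \<Longrightarrow> S.parts (\<beta> A) = T.parts A"
    using edge_set_bij by blast
  have finL: "finite T.leaf_edges" "finite S.leaf_edges"
    using T.finite_E S.finite_E T.leaf_edges_subset S.leaf_edges_subset finite_subset by blast+
  have S_proper: "S.covering S.leaf_edges"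
    using proper parts_leaf_edges_eq T.covering_iff_parts[OF T.leaf_edges_subset] S.covering_iff_parts[OF S.leaf_edges_subset]
    by simp
  have ex: "\<exists>f. f \<in> E' - S.leaf_edges \<and> \<beta> (insert e T.leaf_edges) = insert f S.leaf_edges" if e: "e \<in> E - T.leaf_edges" for e
  proof -
    let ?A = "insert e T.leaf_edges"
    have A: "?A \<subseteq> E" using e T.leaf_edges_subset by blast
    have B: "\<beta> ?A \<subseteq> E'" using b A unfolding bij_betw_def by blast
    have "T.covering ?A" by (rule T.covering_mono[OF proper]) blast
    then have "S.covering (\<beta> ?A)"
      using S.covering_iff_parts[OF B] T.covering_iff_parts[OF A] p[OF A] by simp
    then have sub: "S.leaf_edges \<subseteq> \<beta> ?A" by (rule S.leaf_edges_subset_covering[OF B])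
    have "card (\<beta> ?A) = card S.leaf_edges + 1"
      using card_eq_parts[OF A B p[OF A]] card_leaf_edges_eq e finL by simp
    then have "card (\<beta> ?A - S.leaf_edges) = 1" using sub finL by (simp add: card_Diff_subset)
    then obtain f where f: "\<beta> ?A - S.leaf_edges = {f}" by (rule card_1_singletonE)
    then have "\<beta> ?A = insert f S.leaf_edges" "f \<in> E' - S.leaf_edges" using sub B by blast+
    then show ?thesis by blast
  qed
  define \<gamma> where "\<gamma> e = (SOME f. f \<in> E' - S.leaf_edges \<and> \<beta> (insert e T.leaf_edges) = insert f S.leaf_edges)" for e
  have g: "\<gamma> e \<in> E' - S.leaf_edges \<and> \<beta> (insert e T.leaf_edges) = insert (\<gamma> e) S.leaf_edges"
    if "e \<in> E - T.leaf_edges" for e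
    unfolding \<gamma>_def by (rule someI_ex[OF ex[OF that]])
  have "inj_on \<gamma> (E - T.leaf_edges)"
  proof (rule inj_onI)
    fix e f assume ef: "e \<in> E - T.leaf_edges" "f \<in> E - T.leaf_edges" "\<gamma> e = \<gamma> f"
    then have "\<beta> (insert e T.leaf_edges) = \<beta> (insert f T.leaf_edges)" using g by simp
    moreover have "insert e T.leaf_edges \<in> Pow E" "insert f T.leaf_edges \<in> Pow E"
      using ef T.leaf_edges_subset by blast+
    ultimately have "insert e T.leaf_edges = insert f T.leaf_edges"
      using b unfolding bij_betw_def by (meson inj_onD)
    then show "e = f" using ef by blast
  qed
  moreover have "\<gamma> ` (E - T.leaf_edges) = E' - S.leaf_edges"
    using card_subset_eq[of "E' - S.leaf_edges" "\<gamma> ` (E - T.leaf_edges)"] S.finite_E g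
      card_image[OF \<open>inj_on \<gamma> (E - T.leaf_edges)\<close>] card_core_edges_eq by auto
  ultimately have "bij_betw \<gamma> (E - T.leaf_edges) (E' - S.leaf_edges)" by (simp add: bij_betw_def)
  moreover have "S.parts (insert (\<gamma> e) S.leaf_edges) = T.parts (insert e T.leaf_edges)"
    if "e \<in> E - T.leaf_edges" for e
    using p[of "insert e T.leaf_edges"] g[OF that] that T.leaf_edges_subset by auto
  ultimately show ?thesis using that by blast
qed

end

text \<open>The merged part exceeds both parts it replaces, so it cannot cancel against them.\<close>

lemma merged_parts_unique:
  fixes a b c d :: nat
  assumes "P + {#a, b#} = Q + {#a + b#}" and "P + {#c, d#} = Q + {#c + d#}"
    and "0 < a" "0 < b" "0 < c" "0 < d"
  shows "{#a, b#} = {#c, d#}"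
proof -
  have "(P + {#a, b#}) + (Q + {#c + d#}) = (Q + {#a + b#}) + (P + {#c, d#})"
    unfolding assms(1,2) ..
  then have "(P + Q) + ({#a, b#} + {#c + d#}) = (P + Q) + ({#c, d#} + {#a + b#})"
    by (simp only: ac_simps)
  then have eq: "{#a, b#} + {#c + d#} = {#c, d#} + {#a + b#}" by (rule add_left_imp_eq)
  have "a + b \<in># {#a, b#} + {#c + d#}" unfolding eq by simp
  then have "a + b = c + d" using assms(3-6) by auto
  then show ?thesis using eq by simp
qed

section \<open>Isomorphism of the weighted cores and its extension to the leaves\<close>

context tree_pair
begin

lemma weights_of_core_edge:
  assumes e: "{u, v} \<in> E - T.leaf_edges" and f: "{x, y} \<in> E' - S.leaf_edges"
    and eq: "S.parts (insert {x, y} S.leaf_edges) = T.parts (insert {u, v} T.leaf_edges)"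
  shows "{#T.weight u, T.weight v#} = {#S.weight x, S.weight y#}"
proof (rule merged_parts_unique)
  show "T.parts (insert {u, v} T.leaf_edges) + {#T.weight u, T.weight v#} =
      T.parts T.leaf_edges + {#T.weight u + T.weight v#}"
    by (rule T.parts_insert_core_edge[OF e])
  show "T.parts (insert {u, v} T.leaf_edges) + {#S.weight x, S.weight y#} =
      T.parts T.leaf_edges + {#S.weight x + S.weight y#}"
    using S.parts_insert_core_edge[OF f] eq parts_leaf_edges_eq by simp
  show "0 < T.weight u" "0 < T.weight v" "0 < S.weight x" "0 < S.weight y"
    using e f T.edge_in_V S.edge_in_V T.weight_pos S.weight_pos by blast+
qed

text \<open>A core vertex \<open>u\<close> is sent to the end of \<open>\<gamma> e\<close> that has
  the weight of \<open>u\<close>, for any core edge \<open>e\<close> at \<open>u\<close>. The choice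
  of \<open>e\<close> is harmless: either the weight of \<open>u\<close> occurs once in each core,
  or \<open>u\<close> lies on a single core edge. Core degree at least two is expressed by two
  different neighbours in \<open>isolated\<close>.\<close>

lemma core_isomorphism:
  assumes card_core: "3 \<le> card T.core"
    and isolated: "\<And>u x y v. \<lbrakk>{u, x} \<in> E - T.leaf_edges; {u, y} \<in> E - T.leaf_edges; x \<noteq> y;
      v \<in> T.core; T.weight v = T.weight u\<rbrakk> \<Longrightarrow> v = u"
  obtains \<phi> where "bij_betw \<phi> T.core S.core"
    and "\<And>u. u \<in> T.core \<Longrightarrow> S.weight (\<phi> u) = T.weight u"
    and "\<And>u v. {u, v} \<in> E - T.leaf_edges \<Longrightarrow> {\<phi> u, \<phi> v} \<in> E'"
proof -
  obtain \<gamma> where \<gamma>: "bij_betw \<gamma> (E - T.leaf_edges) (E' - S.leaf_edges)"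
    and parts_\<gamma>: "\<And>e. e \<in> E - T.leaf_edges \<Longrightarrow>
      S.parts (insert (\<gamma> e) S.leaf_edges) = T.parts (insert e T.leaf_edges)"
    using core_edge_bij by blast
  have \<gamma>_in: "\<gamma> e \<in> E' - S.leaf_edges" if "e \<in> E - T.leaf_edges" for e
    using \<gamma> that unfolding bij_betw_def by blast
  have \<gamma>_core: "\<gamma> e \<subseteq> S.core" if e: "e \<in> E - T.leaf_edges" for e
  proof -
    obtain x y where "\<gamma> e = {x, y}" "x \<in> S.core" "y \<in> S.core" using S.core_edgeE[OF \<gamma>_in[OF e]] .
    then show ?thesis by simp
  qed
  define iso where "iso u \<longleftrightarrow> (\<forall>v\<in>T.core. T.weight v = T.weight u \<longrightarrow> v = u)" for u
  have iso': "x = y"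
    if "iso u" and xy: "x \<in> S.core" "y \<in> S.core" "S.weight x = T.weight u" "S.weight y = T.weight u" for u x y
  \<comment> \<open>Uniqueness of a weight carries over to the second core along a weight-preserving
    bijection of the cores, which need not respect edges.\<close>
  proof -
    obtain h where h: "bij_betw h S.core T.core" "\<And>x. x \<in> S.core \<Longrightarrow> T.weight (h x) = S.weight x"
      using bij_if_image_mset_eq[OF S.finite_core T.finite_core weights_eq] by blast
    have "h z = u" if z: "z \<in> S.core" "S.weight z = T.weight u" for z
    proof -
      have "h z \<in> T.core" using h(1) z(1) unfolding bij_betw_def by blast
      moreover have "T.weight (h z) = T.weight u" using h(2) z by simp
      ultimately show ?thesis using \<open>iso u\<close> unfolding iso_def by blast
    qed
    then have "h x = h y" using xy by metis
    then show ?thesis using h(1) xy unfolding bij_betw_def by (metis inj_onD)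
  qed
  have other_end: "\<exists>v. e = {u, v}" if "e \<in> E" "u \<in> e" for e u
    using T.edgeE[OF that(1)] that(2) by (auto simp: insert_commute)
  have single: "e = f"
    if "\<not> iso u" and ef: "e \<in> E - T.leaf_edges" "f \<in> E - T.leaf_edges" "u \<in> e" "u \<in> f" for u e f
  proof -
    obtain x y where "e = {u, x}" "f = {u, y}" using other_end ef by blast
    then show ?thesis using isolated[of u x y] \<open>\<not> iso u\<close> ef(1,2) unfolding iso_def by blast
  qed
  \<comment> \<open>With three core vertices, one end of the edge has core degree at least two, and
    no other core vertex shares its weight.\<close>
  have distinct: "T.weight u \<noteq> T.weight v" if uv: "{u, v} \<in> E - T.leaf_edges" for u v
  proof -
    obtain x y z where x: "x \<in> {u, v}" "y \<noteq> z" "{x, y} \<in> E - T.leaf_edges" "{x, z} \<in> E - T.leaf_edges"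
      using T.core_edge_degree[OF card_core uv] .
    have "u \<in> T.core" "v \<in> T.core" "u \<noteq> v" using uv T.core_edge_iff T.edge_in_V by blast+
    then show ?thesis using x isolated[OF x(3,4,2)] by (metis insertE singletonD)
  qed
  have match: "\<exists>x\<in>\<gamma> e. S.weight x = T.weight u" if e: "e \<in> E - T.leaf_edges" "u \<in> e" for e u
  proof -
    obtain v where v: "e = {u, v}" using other_end e by blast
    obtain x y where xy: "\<gamma> e = {x, y}" using S.core_edgeE[OF \<gamma>_in[OF e(1)]] by metis
    have "{#T.weight u, T.weight v#} = {#S.weight x, S.weight y#}"
      using weights_of_core_edge[of u v x y] e(1) \<gamma>_in[OF e(1)] parts_\<gamma>[OF e(1)] unfolding v[symmetric] xy by simp
    moreover have "T.weight u \<in># {#T.weight u, T.weight v#}" by simp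
    ultimately have "T.weight u \<in># {#S.weight x, S.weight y#}" by simp
    then show ?thesis unfolding xy by auto
  qed
  \<comment> \<open>The edge is quantified away so that \<open>\<phi> u\<close> depends on
    \<open>u\<close> only. That the chosen vertex lies on \<open>\<gamma> e\<close> for every core
    edge \<open>e\<close> at \<open>u\<close> is proved next.\<close>
  define P where "P u x \<longleftrightarrow> (\<exists>e\<in>E - T.leaf_edges. u \<in> e \<and> x \<in> \<gamma> e \<and> S.weight x = T.weight u)" for u x
  define \<phi> where "\<phi> u = (SOME x. P u x)" for u
  have \<phi>: "\<phi> u \<in> \<gamma> e" "S.weight (\<phi> u) = T.weight u" if e: "e \<in> E - T.leaf_edges" "u \<in> e" for u e
  proof -
    obtain x where x: "x \<in> \<gamma> e" "S.weight x = T.weight u" using match[OF e] by blast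
    then have "P u x" unfolding P_def using e by blast
    then have "P u (\<phi> u)" unfolding \<phi>_def by (rule someI)
    then obtain f where f: "f \<in> E - T.leaf_edges" "u \<in> f" "\<phi> u \<in> \<gamma> f" and w: "S.weight (\<phi> u) = T.weight u"
      unfolding P_def by blast
    show "S.weight (\<phi> u) = T.weight u" by (rule w)
    show "\<phi> u \<in> \<gamma> e"
    proof (cases "iso u")
      case True
      then have "\<phi> u = x"
        using iso'[of u "\<phi> u" x] \<gamma>_core[OF f(1)] \<gamma>_core[OF e(1)] f(3) x w by blast
      then show ?thesis using x by simp
    next
      case False
      then show ?thesis using single[OF False f(1) e(1) f(2) e(2)] f(3) by simp
    qed
  qed
  have \<gamma>_eq: "\<gamma> {u, v} = {\<phi> u, \<phi> v}" if uv: "{u, v} \<in> E - T.leaf_edges" for u v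
  proof -
    obtain x y where "\<gamma> {u, v} = {x, y}" using S.core_edgeE[OF \<gamma>_in[OF uv]] by metis
    moreover have "\<phi> u \<in> \<gamma> {u, v}" "\<phi> v \<in> \<gamma> {u, v}" using \<phi>(1)[OF uv] by simp_all
    \<comment> \<open>The images have different weights, so they exhaust the two ends of the image
      edge.\<close>
    moreover have "\<phi> u \<noteq> \<phi> v" using \<phi>(2)[OF uv] distinct[OF uv] by (metis insertCI)
    ultimately show ?thesis by auto
  qed
  have card_core2: "2 \<le> card T.core" "2 \<le> card S.core" using card_core card_core_eq by simp_all
  have edge: "\<exists>e. e \<in> E - T.leaf_edges \<and> u \<in> e" if "u \<in> T.core" for u
    by (rule T.core_edge_ex[OF card_V card_core2(1) that]) blast
  have "\<phi> ` T.core = S.core"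
  proof (intro equalityI subsetI)
    fix x assume "x \<in> \<phi> ` T.core"
    then obtain u where u: "x = \<phi> u" "u \<in> T.core" by blast
    then obtain e where "e \<in> E - T.leaf_edges" "u \<in> e" using edge by blast
    then show "x \<in> S.core" using \<phi>(1) \<gamma>_core u by blast
  next
    fix x assume x: "x \<in> S.core"
    obtain f where f: "f \<in> E' - S.leaf_edges" "x \<in> f"
      using S.core_edge_ex[OF card_V' card_core2(2) x] .
    then obtain e where e: "e \<in> E - T.leaf_edges" "f = \<gamma> e" using \<gamma> unfolding bij_betw_def by blast
    obtain u v where uv: "e = {u, v}" "u \<in> T.core" "v \<in> T.core" using T.core_edgeE[OF e(1)] by metis
    have "f = {\<phi> u, \<phi> v}" using \<gamma>_eq e uv(1) by simp
    then show "x \<in> \<phi> ` T.core" using f(2) uv by blast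
  qed
  \<comment> \<open>A surjection between finite sets of equal size is injective.\<close>
  moreover from this have "inj_on \<phi> T.core"
    by (intro eq_card_imp_inj_on T.finite_core) (simp add: card_core_eq)
  ultimately have "bij_betw \<phi> T.core S.core" by (simp add: bij_betw_def)
  moreover have "S.weight (\<phi> u) = T.weight u" if "u \<in> T.core" for u
    using edge[OF that] \<phi>(2) by blast
  moreover have "{\<phi> u, \<phi> v} \<in> E'" if "{u, v} \<in> E - T.leaf_edges" for u v
    using \<gamma>_eq[OF that] \<gamma>_in[OF that] by simp
  ultimately show ?thesis using that by blast
qed

text \<open>Equal weights mean equally many leaves, so the leaves at each core vertex can be matched
  arbitrarily with those at its image. The resulting map preserves edges, and the converse follows
  because both trees have the same number of edges.\<close>

lemma extend_core_isomorphism: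
  assumes \<phi>: "bij_betw \<phi> T.core S.core"
    and weight: "\<And>u. u \<in> T.core \<Longrightarrow> S.weight (\<phi> u) = T.weight u"
    and edge: "\<And>u v. {u, v} \<in> E - T.leaf_edges \<Longrightarrow> {\<phi> u, \<phi> v} \<in> E'"
  obtains \<Phi> where "bij_betw \<Phi> V V'"
    and "\<And>u v. u \<in> V \<Longrightarrow> v \<in> V \<Longrightarrow> {u, v} \<in> E \<longleftrightarrow> {\<Phi> u, \<Phi> v} \<in> E'"
proof -
  have \<phi>_core: "\<phi> v \<in> S.core" if "v \<in> T.core" for v using \<phi> that unfolding bij_betw_def by blast
  have "\<exists>f. bij_betw f (T.leaves_at v) (S.leaves_at (\<phi> v))" if v: "v \<in> T.core" for v
    using weight[OF v] T.weight_core[OF v] S.weight_core[OF \<phi>_core[OF v]]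
    by (intro finite_same_card_bij T.finite_leaves_at S.finite_leaves_at) simp
  then obtain \<psi> where \<psi>: "bij_betw (\<psi> v) (T.leaves_at v) (S.leaves_at (\<phi> v))" if "v \<in> T.core" for v
    by metis
  \<comment> \<open>For a leaf \<open>u\<close> this is its only neighbour; it selects which of the
    leaf bijections applies to \<open>u\<close>.\<close>
  define p where "p u = (SOME v. {u, v} \<in> E)" for u
  have p: "{u, p u} \<in> E" "p u \<in> T.core" "u \<in> T.leaves_at (p u)" if u: "T.leaf u" for u
  proof -
    obtain v where "{u, v} \<in> E" using T.leaf_neighbour_ex[OF u] .
    then show pu: "{u, p u} \<in> E" unfolding p_def by (rule someI)
    show "p u \<in> T.core"
      using T.leaf_neighbour_not_leaf[OF card_V u pu] T.edge_in_V[OF pu] by (simp add: T.core_def)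
    show "u \<in> T.leaves_at (p u)" using u pu by (simp add: T.leaves_at_def)
  qed
  define \<Phi> where "\<Phi> u = (if u \<in> T.core then \<phi> u else \<psi> (p u) u)" for u
  have leaf_or_core: "T.leaf u \<or> u \<in> T.core" if "u \<in> V" for u using that by (simp add: T.core_def)
  have leaf_core: "u \<notin> T.core" if "T.leaf u" for u using that by (simp add: T.core_def)
  have \<Phi>_leaf: "\<Phi> u \<in> S.leaves_at (\<phi> (p u))" if u: "T.leaf u" for u
    using \<psi>[OF p(2)[OF u]] p(3)[OF u] leaf_core[OF u] unfolding \<Phi>_def bij_betw_def by auto
  then have \<Phi>_leaf': "S.leaf (\<Phi> u)" "{\<Phi> u, \<phi> (p u)} \<in> E'" if "T.leaf u" for u
    using that by (auto simp: S.leaves_at_def)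
  have \<Phi>_core: "\<Phi> u \<in> S.core" if "u \<in> T.core" for u using that \<phi>_core by (simp add: \<Phi>_def)
  have inj: "inj_on \<Phi> V"
  proof (rule inj_onI)
    fix u v assume uv: "u \<in> V" "v \<in> V" "\<Phi> u = \<Phi> v"
    \<comment> \<open>Leaves go to leaves and core vertices to core vertices, so the mixed cases
      cannot occur.\<close>
    consider "T.leaf u" "T.leaf v" | "u \<in> T.core" "v \<in> T.core"
      using leaf_or_core[OF uv(1)] leaf_or_core[OF uv(2)] \<Phi>_leaf'(1)[of u] \<Phi>_leaf'(1)[of v]
        \<Phi>_core[of u] \<Phi>_core[of v] uv(3) by (auto simp: S.core_def)
    then show "u = v"
    proof cases
      case 1
      have "\<phi> (p u) = \<phi> (p v)"
        using S.leaf_neighbour_unique[of "\<Phi> u" "\<phi> (p u)" "\<phi> (p v)"] \<Phi>_leaf'[OF 1(1)] \<Phi>_leaf'[OF 1(2)] uv(3) by simp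
      then have eq: "p u = p v" using \<phi> p(2)[OF 1(1)] p(2)[OF 1(2)] unfolding bij_betw_def by (meson inj_onD)
      then have "\<psi> (p u) u = \<psi> (p u) v"
        using uv(3) leaf_core[OF 1(1)] leaf_core[OF 1(2)] by (simp add: \<Phi>_def)
      moreover have "v \<in> T.leaves_at (p u)" using p(3)[OF 1(2)] eq by simp
      ultimately show ?thesis
        using \<psi>[OF p(2)[OF 1(1)]] p(3)[OF 1(1)] unfolding bij_betw_def by (meson inj_onD)
    next
      case 2
      then show ?thesis using uv(3) \<phi> unfolding bij_betw_def \<Phi>_def by (auto dest: inj_onD)
    qed
  qed
  have "\<Phi> u \<in> V'" if "u \<in> V" for u
    using leaf_or_core[OF that] \<Phi>_leaf'(1)[of u] \<Phi>_core[of u] by (auto simp: S.core_def S.leaf_def)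
  then have "\<Phi> ` V = V'"
    using card_subset_eq[OF S.finite_V, of "\<Phi> ` V"] card_image[OF inj] card_V_eq by auto
  with inj have bij: "bij_betw \<Phi> V V'" by (simp add: bij_betw_def)
  have leaf_edge: "{\<Phi> u, \<Phi> v} \<in> E'" if u: "T.leaf u" and uv: "{u, v} \<in> E" for u v
  proof -
    have "v = p u" using T.leaf_neighbour_unique[OF u uv p(1)[OF u]] .
    then show ?thesis using \<Phi>_leaf'(2)[OF u] p(2)[OF u] by (simp add: \<Phi>_def)
  qed
  have fwd: "{\<Phi> u, \<Phi> v} \<in> E'" if uv: "{u, v} \<in> E" for u v
  proof -
    have vu: "{v, u} \<in> E" using uv by (simp add: insert_commute)
    consider "T.leaf u" | "T.leaf v" | "u \<in> T.core" "v \<in> T.core"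
      using T.edge_in_V[OF uv] leaf_or_core by blast
    then show ?thesis
    proof cases
      case 1
      then show ?thesis using uv by (rule leaf_edge)
    next
      case 2
      then show ?thesis using leaf_edge[OF 2 vu] by (simp add: insert_commute)
    next
      case 3
      then show ?thesis using edge[of u v] T.core_edge_iff[of u v] uv by (simp add: \<Phi>_def)
    qed
  qed
  have E_sub: "e \<subseteq> V" if "e \<in> E" for e using T.edgeE[OF that] by auto
  have injE: "inj_on ((`) \<Phi>) E"
    by (rule inj_onI) (metis E_sub inj inj_on_image_eq_iff)
  have "(`) \<Phi> ` E \<subseteq> E'"
  proof (rule image_subsetI)
    fix e assume e: "e \<in> E"
    obtain u v where "e = {u, v}" using T.edgeE[OF e] by blast
    then show "\<Phi> ` e \<in> E'" using fwd[of u v] e by simp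
  qed
  \<comment> \<open>The induced map on edges is injective into a set of the same size, hence onto.
    This yields the reverse direction of the edge equivalence.\<close>
  then have imgE: "(`) \<Phi> ` E = E'"
    using card_subset_eq[OF S.finite_E, of "(`) \<Phi> ` E"] card_image[OF injE] card_E_eq by auto
  have "{u, v} \<in> E" if uv: "u \<in> V" "v \<in> V" "{\<Phi> u, \<Phi> v} \<in> E'" for u v
  proof -
    obtain e where e: "e \<in> E" "\<Phi> ` e = \<Phi> ` {u, v}" using imgE uv(3) by (metis image_empty image_iff image_insert)
    then have "e = {u, v}" using inj_on_image_eq_iff[OF inj E_sub[OF e(1)], of "{u, v}"] uv(1,2) by simp
    then show ?thesis using e(1) by simp
  qed
  with fwd bij that show ?thesis by blast
qed

end

section \<open>Symmetric digraphs as edge sets\<close>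

definition edge_set :: "('a, 'b) pre_digraph \<Rightarrow> 'a set set" where
  "edge_set G = {{u, v} | u v. u \<rightarrow>\<^bsub>G\<^esub> v}"

lemma (in graph) edge_set_iff: "{u, v} \<in> edge_set G \<longleftrightarrow> u \<rightarrow> v"
  using arcs_ends_symmetric[OF sym_arcs] by (auto simp: edge_set_def doubleton_eq_iff)

lemma (in graph) adj_edge_set: "adj (edge_set G) = arcs_ends G"
  by (auto simp: adj_def edge_set_iff)

lemma (in graph) edge_set_elem:
  assumes "e \<in> edge_set G"
  shows "\<exists>u v. e = {u, v} \<and> u \<noteq> v \<and> u \<in> verts G \<and> v \<in> verts G"
proof -
  obtain u v where "e = {u, v}" "u \<rightarrow> v" using assms by (auto simp: edge_set_def)
  then show ?thesis using adj_in_verts adj_not_same by blast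
qed

text \<open>Without parallel arcs, the arcs leaving \<open>v\<close> correspond one to one to the
  edges at \<open>v\<close>.\<close>

lemma (in graph) card_edges_at: "card {e \<in> edge_set G. v \<in> e} = out_degree G v"
proof -
  have "(\<lambda>a. {tail G a, head G a}) ` out_arcs G v = {e \<in> edge_set G. v \<in> e}"
  proof (intro equalityI subsetI)
    fix e assume "e \<in> {e \<in> edge_set G. v \<in> e}"
    moreover from this obtain w where w: "e = {v, w}" using edge_set_elem[of e] by (auto simp: insert_commute)
    ultimately have "v \<rightarrow> w" using edge_set_iff by simp
    then obtain a where "a \<in> arcs G" "tail G a = v" "head G a = w" by (rule reachableE)
    then show "e \<in> (\<lambda>a. {tail G a, head G a}) ` out_arcs G v" using w by auto
  next
    fix e assume "e \<in> (\<lambda>a. {tail G a, head G a}) ` out_arcs G v"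
    then show "e \<in> {e \<in> edge_set G. v \<in> e}" by (auto simp: edge_set_iff in_arcs_imp_in_arcs_ends)
  qed
  moreover have "inj_on (\<lambda>a. {tail G a, head G a}) (out_arcs G v)"
  proof (rule inj_onI)
    fix a b assume "a \<in> out_arcs G v" "b \<in> out_arcs G v" "{tail G a, head G a} = {tail G b, head G b}"
    then show "a = b" by (intro no_multi_arcs) (auto simp: arc_to_ends_def doubleton_eq_iff)
  qed
  ultimately show ?thesis unfolding out_degree_def by (metis card_image)
qed

lemma (in graph) awalk_if_component:
  assumes "v \<in> component (edge_set G - {f}) u" and "u \<in> verts G"
  shows "\<exists>p. awalk u p v \<and> (\<forall>a\<in>set p. {tail G a, head G a} \<noteq> f)"
proof -
  have "(u, v) \<in> (adj (edge_set G - {f}))\<^sup>*" using assms(1) by (simp add: component_def)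
  then show ?thesis
  proof (induction rule: rtrancl_induct)
    case base
    show ?case using assms(2) by (intro exI[of _ "[]"]) (simp add: awalk_Nil_iff)
  next
    case (step x y)
    then obtain p where p: "awalk u p x" "\<forall>a\<in>set p. {tail G a, head G a} \<noteq> f" by blast
    have "{x, y} \<in> edge_set G" and ne: "{x, y} \<noteq> f" using step.hyps(2) by (auto simp: adj_def)
    then obtain a where a: "a \<in> arcs G" "tail G a = x" "head G a = y"
      using edge_set_iff reachableE by metis
    then have "awalk x [a] y" using arc_implies_awalk by blast
    with p(1) have "awalk u (p @ [a]) y" by (rule awalk_appendI)
    with p(2) a ne show ?case by (intro exI[of _ "p @ [a]"]) auto
  qed
qed

text \<open>For the bridge property, a walk from \<open>u\<close> to \<open>v\<close> avoiding the
  edge between them is shortened to a path and closed by the arc from \<open>v\<close> to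
  \<open>u\<close>, which gives a forbidden cycle.\<close>

lemma edge_tree_if_undirected_tree:
  assumes "undirected_tree G"
  shows "edge_tree (verts G) (edge_set G)"
proof -
  interpret graph G using assms by (simp add: undirected_tree_def)
  have "strongly_connected (mk_symmetric G)" using assms by (simp add: undirected_tree_def connected_def)
  then have reach: "u \<rightarrow>\<^sup>*\<^bsub>G\<^esub> v" if "u \<in> verts G" "v \<in> verts G" for u v
    using that reachable_mk_symmetric_eq[OF sym_arcs] by (simp add: strongly_connected_def mk_symmetric_def)
  show ?thesis
  proof
    show "finite (verts G)" by simp
  next
    fix e assume "e \<in> edge_set G"
    then show "\<exists>u v. e = {u, v} \<and> u \<noteq> v \<and> u \<in> verts G \<and> v \<in> verts G" by (rule edge_set_elem)
  next
    fix u assume u: "u \<in> verts G"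
    show "component (edge_set G) u = verts G"
    proof
      show "component (edge_set G) u \<subseteq> verts G"
        using u adj_in_verts by (intro component_least) (auto simp: edge_set_iff)
      show "verts G \<subseteq> component (edge_set G) u"
        using reach[OF u] reachable_rtranclI by (force simp: component_def adj_edge_set)
    qed
  next
    fix u v assume uv: "{u, v} \<in> edge_set G"
    show "v \<notin> component (edge_set G - {{u, v}}) u"
    proof
      assume v: "v \<in> component (edge_set G - {{u, v}}) u"
      have "u \<rightarrow>\<^bsub>G\<^esub> v" "v \<rightarrow>\<^bsub>G\<^esub> u" using uv edge_set_iff[of u v] edge_set_iff[of v u] by (simp_all add: insert_commute)
      then obtain e where e: "e \<in> arcs G" "tail G e = v" "head G e = u" by (auto elim: reachableE)
      have u: "u \<in> verts G" and ne: "u \<noteq> v" using \<open>u \<rightarrow>\<^bsub>G\<^esub> v\<close> adj_in_verts adj_not_same by blast+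
      obtain p where p: "awalk u p v" "\<forall>a\<in>set p. {tail G a, head G a} \<noteq> {u, v}"
        using awalk_if_component[OF v u] by blast
      let ?q = "awalk_to_apath p"
      have q: "apath u ?q v" using p(1) by (rule apath_awalk_to_apath)
      have q': "\<forall>a\<in>set ?q. {tail G a, head G a} \<noteq> {u, v}"
        using awalk_to_apath_subset[OF p(1)] p(2) by blast
      \<comment> \<open>This makes the closed walk a cycle with at least three arcs, so that it is
        not the back-and-forth walk along one edge. The path is not empty since \<open>u\<close> and
        \<open>v\<close> differ, and a single arc would lie on the avoided edge.\<close>
      have "length ?q \<ge> 2"
      proof (rule ccontr)
        assume "\<not> length ?q \<ge> 2"
        then consider "?q = []" | a where "?q = [a]" by (cases ?q) (auto simp: Suc_le_eq)
        then show False
        proof cases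
          case 1
          then show ?thesis using q ne by (simp add: apath_Nil_iff)
        next
          case 2
          then show ?thesis using q q' by (auto simp: apath_Cons_iff apath_Nil_iff)
        qed
      qed
      moreover have "cycle (e # ?q)"
        unfolding cycle_def using q e by (intro exI[of _ v]) (auto simp: awalk_Cons_iff apath_def)
      ultimately show False using assms unfolding undirected_tree_def by fastforce
    qed
  qed
qed

section \<open>Translation of colourings, leaves and core weights to edge sets\<close>

lemma chromatic_symmetric_function_eq_types:
  assumes "undirected_tree G"
  shows "chromatic_symmetric_function G m =
    (\<Sum>\<mu>\<in>#edge_tree.types (verts G) (edge_set G). (-1) ^ (sum_mset \<mu> + size \<mu>) * int (power_sum_coeff \<mu> m))"
proof -
  interpret graph G using assms by (simp add: undirected_tree_def)
  interpret T: edge_tree "verts G" "edge_set G" using assms by (rule edge_tree_if_undirected_tree)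
  have "(\<forall>u v. u \<rightarrow>\<^bsub>G\<^esub> v \<longrightarrow> \<kappa> u \<noteq> \<kappa> v) \<longleftrightarrow> (\<forall>e\<in>edge_set G. \<exists>x\<in>e. \<exists>y\<in>e. \<kappa> x \<noteq> \<kappa> y)" for \<kappa> :: "'a \<Rightarrow> nat"
  proof -
    have "(\<exists>x\<in>{u, v}. \<exists>y\<in>{u, v}. \<kappa> x \<noteq> \<kappa> y) \<longleftrightarrow> \<kappa> u \<noteq> \<kappa> v" for u v by auto
    moreover have "(\<forall>e\<in>edge_set G. Q e) \<longleftrightarrow> (\<forall>u v. u \<rightarrow>\<^bsub>G\<^esub> v \<longrightarrow> Q {u, v})" for Q
      unfolding edge_set_def by blast
    ultimately show ?thesis by simp
  qed
  then have "{\<kappa> \<in> proper_colorings G. (\<Sum>v\<in>verts G. Poly_Mapping.single (\<kappa> v) 1) = m} =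
      {\<kappa> \<in> verts G \<rightarrow>\<^sub>E {1..}. (\<Sum>v\<in>verts G. Poly_Mapping.single (\<kappa> v) 1) = m \<and>
        (\<forall>e\<in>edge_set G. \<exists>x\<in>e. \<exists>y\<in>e. \<kappa> x \<noteq> \<kappa> y)}"
    unfolding proper_colorings_def by blast
  then show ?thesis
    by (simp only: chromatic_symmetric_function_eq_card[OF finite_verts] T.proper_colouring_count_types)
qed

lemma is_leaf_iff:
  assumes "undirected_tree G"
  shows "is_leaf G v \<longleftrightarrow> edge_tree.leaf (verts G) (edge_set G) v"
proof -
  interpret graph G using assms by (simp add: undirected_tree_def)
  interpret T: edge_tree "verts G" "edge_set G" using assms by (rule edge_tree_if_undirected_tree)
  have "out_degree G v = 1 \<longleftrightarrow> (\<exists>!e. e \<in> edge_set G \<and> v \<in> e)"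
  proof -
    have "out_degree G v = 1 \<longleftrightarrow> (\<exists>e. {e \<in> edge_set G. v \<in> e} = {e})"
      by (simp add: card_edges_at[symmetric] card_1_singleton_iff)
    also have "\<dots> \<longleftrightarrow> (\<exists>!e. e \<in> edge_set G \<and> v \<in> e)"
    proof
      assume "\<exists>!e. e \<in> edge_set G \<and> v \<in> e"
      then obtain e where "e \<in> edge_set G \<and> v \<in> e" "\<And>f. f \<in> edge_set G \<and> v \<in> f \<Longrightarrow> f = e"
        by (elim ex1E) iprover
      then have "{e \<in> edge_set G. v \<in> e} = {e}" by blast
      then show "\<exists>e. {e \<in> edge_set G. v \<in> e} = {e}" ..
    next
      assume "\<exists>e. {e \<in> edge_set G. v \<in> e} = {e}"
      then obtain e where e: "{e \<in> edge_set G. v \<in> e} = {e}" ..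
      have "f \<in> edge_set G \<and> v \<in> f \<longleftrightarrow> f = e" for f
        using arg_cong[OF e, of "\<lambda>X. f \<in> X"] by simp
      then show "\<exists>!e. e \<in> edge_set G \<and> v \<in> e" by simp
    qed
    finally show ?thesis .
  qed
  then show ?thesis by (simp add: is_leaf_def T.leaf_def)
qed

lemma internal_core_verts:
  assumes "undirected_tree G"
  shows "verts (internal_core G) = edge_tree.core (verts G) (edge_set G)"
  using edge_tree.core_def[OF edge_tree_if_undirected_tree[OF assms]] is_leaf_iff[OF assms]
  by (simp add: internal_core_def)

lemma core_weight_eq:
  assumes "undirected_tree G" and "v \<in> verts (internal_core G)"
  shows "core_weight G v = edge_tree.weight (verts G) (edge_set G) v"
proof -
  interpret graph G using assms by (simp add: undirected_tree_def)
  interpret T: edge_tree "verts G" "edge_set G" using assms(1) by (rule edge_tree_if_undirected_tree)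
  have "{u \<in> verts G. is_leaf G u \<and> u \<rightarrow>\<^bsub>G\<^esub> v} = T.leaves_at v"
    using is_leaf_iff[OF assms(1)] by (auto simp: T.leaves_at_def edge_set_iff T.leaf_def)
  then show ?thesis
    using T.weight_core assms by (simp add: core_weight_def internal_core_verts)
qed

lemma covering_leaf_edges_if_proper:
  assumes "proper_tree G"
  shows "edge_tree.covering (verts G) (edge_tree.leaf_edges (verts G) (edge_set G))"
proof -
  have tree: "undirected_tree G" using assms by (simp add: proper_tree_def)
  interpret graph G using tree by (simp add: undirected_tree_def)
  interpret T: edge_tree "verts G" "edge_set G" using tree by (rule edge_tree_if_undirected_tree)
  show ?thesis
    unfolding T.covering_def
  proof
    fix v assume v: "v \<in> verts G"
    show "\<exists>e\<in>T.leaf_edges. v \<in> e"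
    proof (cases "T.leaf v")
      case True
      then obtain w where "{v, w} \<in> edge_set G" by (rule T.leaf_neighbour_ex)
      then show ?thesis using True by (intro bexI[of _ "{v, w}"]) (auto simp: T.leaf_edges_def)
    next
      case False
      then have "v \<in> verts (internal_core G)" using v internal_core_verts[OF tree] by (simp add: T.core_def)
      then obtain u where "T.leaf u" "u \<rightarrow>\<^bsub>G\<^esub> v"
        using assms is_leaf_iff[OF tree] unfolding proper_tree_def by blast
      then show ?thesis by (intro bexI[of _ "{u, v}"]) (auto simp: T.leaf_edges_def edge_set_iff)
    qed
  qed
qed

text \<open>Two different core neighbours of \<open>u\<close> give two arcs leaving \<open>u\<close>
  inside the core, so the isolation hypothesis applies to \<open>u\<close>.\<close>

lemma isolated_weight:
  assumes "undirected_tree G" and "multiplicity_isolated (internal_core G) (core_weight G)"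
    and "x \<noteq> y"
    and "{u, x} \<in> edge_set G - edge_tree.leaf_edges (verts G) (edge_set G)"
    and "{u, y} \<in> edge_set G - edge_tree.leaf_edges (verts G) (edge_set G)"
    and "v \<in> edge_tree.core (verts G) (edge_set G)"
    and "edge_tree.weight (verts G) (edge_set G) v = edge_tree.weight (verts G) (edge_set G) u"
  shows "v = u"
proof -
  interpret graph G using assms by (simp add: undirected_tree_def)
  interpret T: edge_tree "verts G" "edge_set G" using assms(1) by (rule edge_tree_if_undirected_tree)
  let ?C = "internal_core G"
  have core: "u \<in> verts ?C" "x \<in> verts ?C" "y \<in> verts ?C" "v \<in> verts ?C"
    using assms(4-6) T.core_edge_iff internal_core_verts[OF assms(1)] by blast+
  have "u \<rightarrow>\<^bsub>G\<^esub> x" "u \<rightarrow>\<^bsub>G\<^esub> y" using assms(4,5) edge_set_iff by blast+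
  then obtain a b where ab: "a \<in> arcs G" "tail G a = u" "head G a = x" "b \<in> arcs G" "tail G b = u" "head G b = y"
    by (metis reachableE)
  then have sub: "{a, b} \<subseteq> out_arcs ?C u" using core by (auto simp: internal_core_def)
  have "out_arcs ?C u \<subseteq> arcs G" by (auto simp: internal_core_def)
  then have "finite (out_arcs ?C u)" using finite_arcs finite_subset by blast
  then have "card {a, b} \<le> out_degree ?C u" unfolding out_degree_def using sub by (rule card_mono)
  moreover have "a \<noteq> b" using ab assms(3) by auto
  ultimately have "2 \<le> out_degree ?C u" by simp
  then have "{w \<in> verts ?C. core_weight G w = core_weight G u} = {u}"
    using assms(2) core(1) unfolding multiplicity_isolated_def by blast
  moreover have "core_weight G v = core_weight G u"
    using core_weight_eq[OF assms(1)] core assms(7) by simp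
  ultimately show ?thesis using core(4) by blast
qed

text \<open>On the first four arcs of a longest path, the three inner vertices each have two
  different neighbours, so none of them is a leaf.\<close>

lemma card_core_if_diameter:
  assumes tree: "undirected_tree G" and d: "graph_diameter G \<ge> 4"
  shows "3 \<le> card (edge_tree.core (verts G) (edge_set G))"
proof -
  interpret graph G using tree by (simp add: undirected_tree_def)
  interpret T: edge_tree "verts G" "edge_set G" using tree by (rule edge_tree_if_undirected_tree)
  let ?S = "{length p | u p v. apath u p v}"
  \<comment> \<open>\<open>Max\<close> is attained only on a finite nonempty set: path lengths are
    bounded, and connectedness excludes the null graph, so an empty path exists.\<close>
  have "?S \<subseteq> {..card (verts G)}" using length_apath by auto
  then have "finite ?S" by (rule finite_subset) simp
  moreover have "?S \<noteq> {}"
  proof -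
    have "strongly_connected (mk_symmetric G)" using tree by (simp add: undirected_tree_def connected_def)
    then obtain v where "v \<in> verts G" by (auto simp: strongly_connected_def mk_symmetric_def)
    then have "apath v [] v" by (simp add: apath_Nil_iff)
    then show ?thesis by blast
  qed
  ultimately have "graph_diameter G \<in> ?S" unfolding graph_diameter_def by (rule Max_in)
  then obtain u p v where p: "apath u p v" "4 \<le> length p" using d by auto
  then obtain a b c e r where "p = a # b # c # e # r"
    by (auto simp: neq_Nil_conv numeral_eq_Suc Suc_le_length_iff)
  with p(1) have r: "apath u (a # b # c # e # r) v" by simp
  have arcs: "a \<in> arcs G" "b \<in> arcs G" "c \<in> arcs G" "e \<in> arcs G"
    and join: "head G a = tail G b" "head G b = tail G c" "head G c = tail G e"
    using r by (auto simp: apath_Cons_iff)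
  have d: "distinct [tail G a, tail G b, tail G c, tail G e, head G e]"
    using r hd_in_awalk_verts(2) by (fastforce simp: apath_Cons_iff)
  have core: "y \<in> T.core" if "{y, x} \<in> edge_set G" "{y, z} \<in> edge_set G" "x \<noteq> z" for x y z
    using that T.edge_in_V[of y x] T.leaf_neighbour_unique[of y x z] by (auto simp: T.core_def)
  have e: "{tail G f, head G f} \<in> edge_set G" if "f \<in> arcs G" for f
    using that by (simp add: edge_set_iff in_arcs_imp_in_arcs_ends)
  have "tail G b \<in> T.core" "tail G c \<in> T.core" "tail G e \<in> T.core"
    using core[of "tail G b" "tail G a" "tail G c"] core[of "tail G c" "tail G b" "tail G e"]
      core[of "tail G e" "tail G c" "head G e"] e[OF arcs(1)] e[OF arcs(2)] e[OF arcs(3)] e[OF arcs(4)] d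
    unfolding join by (auto simp: insert_commute)
  then have "{tail G b, tail G c, tail G e} \<subseteq> T.core" by blast
  then have "card {tail G b, tail G c, tail G e} \<le> card T.core" by (intro card_mono T.finite_core)
  then show ?thesis using d by simp
qed

text \<open>Since there are no parallel arcs, an arc is determined by its ends, so a bijection of
  the vertices that respects adjacency has a unique companion on the arcs.\<close>

lemma digraph_iso_if_bij:
  assumes "graph G" and "graph H" and f: "bij_betw f (verts G) (verts H)"
    and adj: "\<And>u v. u \<in> verts G \<Longrightarrow> v \<in> verts G \<Longrightarrow> u \<rightarrow>\<^bsub>G\<^esub> v \<longleftrightarrow> f u \<rightarrow>\<^bsub>H\<^esub> f v"
  shows "digraph_iso G H"
proof -
  interpret G: graph G by fact
  interpret H: graph H by fact
  define P where "P a b \<longleftrightarrow> b \<in> arcs H \<and> tail H b = f (tail G a) \<and> head H b = f (head G a)" for a b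
  define g where "g a = (SOME b. P a b)" for a
  have uniq: "b = c" if "P a b" "P a c" for a b c
    using that by (intro H.no_multi_arcs) (auto simp: P_def arc_to_ends_def)
  have g: "P a (g a)" if a: "a \<in> arcs G" for a
  proof -
    have "tail G a \<rightarrow>\<^bsub>G\<^esub> head G a" using a by (rule G.in_arcs_imp_in_arcs_ends)
    then have "f (tail G a) \<rightarrow>\<^bsub>H\<^esub> f (head G a)" using adj a by simp
    then have "\<exists>b. P a b" unfolding P_def by (metis reachableE)
    then show ?thesis unfolding g_def by (rule someI_ex)
  qed
  have inj: "inj_on g (arcs G)"
  proof (rule inj_onI)
    fix a b assume ab: "a \<in> arcs G" "b \<in> arcs G" "g a = g b"
    then have "f (tail G a) = f (tail G b)" "f (head G a) = f (head G b)"
      using g[of a] g[of b] by (auto simp: P_def)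
    then have "tail G a = tail G b" "head G a = head G b"
      using f ab unfolding bij_betw_def by (meson G.tail_in_verts G.head_in_verts inj_onD)+
    then show "a = b" using ab by (intro G.no_multi_arcs) (auto simp: arc_to_ends_def)
  qed
  have img: "g ` arcs G = arcs H"
  proof (intro equalityI subsetI)
    fix b assume "b \<in> g ` arcs G"
    then show "b \<in> arcs H" using g by (auto simp: P_def)
  next
    fix b assume b: "b \<in> arcs H"
    obtain u v where uv: "u \<in> verts G" "v \<in> verts G" "tail H b = f u" "head H b = f v"
      using f H.tail_in_verts[OF b] H.head_in_verts[OF b] unfolding bij_betw_def by (metis imageE)
    have "u \<rightarrow>\<^bsub>G\<^esub> v" using adj uv H.in_arcs_imp_in_arcs_ends[OF b] by simp
    then obtain a where a: "a \<in> arcs G" "tail G a = u" "head G a = v" by (rule reachableE)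
    then have "P a b" using b uv by (simp add: P_def)
    then have "b = g a" using uniq g[OF a(1)] by blast
    then show "b \<in> g ` arcs G" using a(1) by blast
  qed
  \<comment> \<open>The head and tail maps are taken from \<open>H\<close> itself, so that the image
    of \<open>G\<close> is literally \<open>H\<close>.\<close>
  let ?hom = "\<lparr>iso_verts = f, iso_arcs = g, iso_head = head H, iso_tail = tail H\<rparr>"
  have "G.digraph_isomorphism ?hom"
    using f inj g G.wf_digraph_axioms unfolding G.digraph_isomorphism_def bij_betw_def P_def by simp
  moreover have "H = app_iso ?hom G"
    using f img by (simp add: app_iso_def bij_betw_def)
  ultimately show ?thesis unfolding digraph_iso_def by blast
qed

theorem corollary3p2:
  fixes T :: "('a, 'b) pre_digraph" and T' :: "('c, 'd) pre_digraph"
  assumes "proper_tree T"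
    and "graph_diameter T = 6"
    and "multiplicity_isolated (internal_core T) (core_weight T)"
    and "undirected_tree T'"
    and "chromatic_symmetric_function T' = chromatic_symmetric_function T"
  shows "digraph_iso T' T"
proof -
  have tree: "undirected_tree T" using assms(1) by (simp add: proper_tree_def)
  interpret T: graph T using tree by (simp add: undirected_tree_def)
  interpret T': graph T' using assms(4) by (simp add: undirected_tree_def)
  let ?V = "verts T" and ?E = "edge_set T" and ?V' = "verts T'" and ?E' = "edge_set T'"
  interpret A: edge_tree ?V ?E using tree by (rule edge_tree_if_undirected_tree)
  interpret B: edge_tree ?V' ?E' using assms(4) by (rule edge_tree_if_undirected_tree)
  \<comment> \<open>Diameter six provides a path with at least four arcs.\<close>
  have card_core: "3 \<le> card A.core" using card_core_if_diameter[OF tree] assms(2) by simp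
  also have "\<dots> \<le> card ?V" by (intro card_mono) (auto simp: A.core_def)
  finally have card_V: "3 \<le> card ?V" .
  have types: "A.types = B.types"
  proof (rule power_sums_independent)
    show "0 \<notin># \<mu>" if "\<mu> \<in># A.types + B.types" for \<mu>
      using that A.parts_pos B.parts_pos A.finite_E B.finite_E by (auto simp: A.types_def B.types_def)
    show "(\<Sum>\<mu>\<in>#A.types. (-1) ^ (sum_mset \<mu> + size \<mu>) * int (power_sum_coeff \<mu> m)) =
        (\<Sum>\<mu>\<in>#B.types. (-1) ^ (sum_mset \<mu> + size \<mu>) * int (power_sum_coeff \<mu> m))" for m
      using chromatic_symmetric_function_eq_types[OF tree, of m]
        chromatic_symmetric_function_eq_types[OF assms(4), of m] assms(5) by simp
  qed simp
  interpret P: tree_pair ?V ?E ?V' ?E'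
    using types card_V covering_leaf_edges_if_proper[OF assms(1)] by unfold_locales
  obtain \<phi> where \<phi>: "bij_betw \<phi> A.core B.core"
    "\<And>u. u \<in> A.core \<Longrightarrow> B.weight (\<phi> u) = A.weight u"
    "\<And>u v. {u, v} \<in> ?E - A.leaf_edges \<Longrightarrow> {\<phi> u, \<phi> v} \<in> ?E'"
    using P.core_isomorphism[OF card_core] isolated_weight[OF tree assms(3)] by metis
  obtain \<Phi> where bij: "bij_betw \<Phi> ?V ?V'"
    and edges: "\<And>u v. u \<in> ?V \<Longrightarrow> v \<in> ?V \<Longrightarrow> {u, v} \<in> ?E \<longleftrightarrow> {\<Phi> u, \<Phi> v} \<in> ?E'"
    using P.extend_core_isomorphism[OF \<phi>] by metis
  show ?thesis
  \<comment> \<open>\<open>\<Phi>\<close> leads from \<open>T\<close> to \<open>T'\<close>, so its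
    inverse is used for the stated direction.\<close>
  proof (rule digraph_iso_if_bij)
    show "graph T'" "graph T" by unfold_locales
    show inv: "bij_betw (inv_into ?V \<Phi>) ?V' ?V" using bij by (rule bij_betw_inv_into)
    fix u v assume "u \<in> ?V'" "v \<in> ?V'"
    then show "u \<rightarrow>\<^bsub>T'\<^esub> v \<longleftrightarrow> inv_into ?V \<Phi> u \<rightarrow>\<^bsub>T\<^esub> inv_into ?V \<Phi> v"
      using edges[of "inv_into ?V \<Phi> u" "inv_into ?V \<Phi> v"] bij inv
      by (simp add: bij_betw_inv_into_right bij_betwE T.edge_set_iff T'.edge_set_iff)
  qed
qed

end
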